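(* Let $\Omega=\mathbb{T}^1$, let $\beta>0$, let $P,\mu$ be smooth functions on $(0,\infty)$ with $\mu>0$, and let $\mathcal{F},\mathcal{H}$ be smooth functionals of pairs $(\rho,m)$ of functions on $\Omega$ with $\rho>0$. Let $(\rho_0,m_0)$ be a given pair of smooth functions on $\Omega$ with $\rho_0>0$. Consider the variational problem $$\inf_{\rho,m,a,\rho_1,m_1}\ \int_0^1\Big[\int_\Omega \tfrac12|a(t,x)|^2\mu(\rho(t,x))\,dx-\mathcal{F}(\rho(t,\cdot),m(t,\cdot))\Big]dt+\mathcal{H}(\rho_1,m_1),$$ where the infimum is over $\rho\colon[0,1]\times\Omega\to(0,\infty)$, $m,a\colon[0,1]\times\Omega\to\mathbb{R}$, $\rho_1=\rho(1,\cdot)$, $m_1=m(1,\cdot)$ satisfying $$\partial_t\rho+\partial_x m=0,\qquad \partial_t m+\partial_x\Big(\frac{m^2}{\rho}\Big)+\partial_xP(\rho)+\partial_x(\mu(\rho)a)=\beta\,\partial_x\Big(\mu(\rho)\partial_x\frac{m}{\rho}\Big),$$ with $\rho(0,x)=\rho_0(x)$, $m(0,x)=m_0(x)$. The critical point system of this variational problem is the following: there exists a pair of functions $\phi,\psi\colon[0,1]\times\Omega\to\mathbb{R}$ such that $a(t,x)=\partial_x\psi(t,x)$ and $$\left\{\begin{aligned} &\partial_t\rho+\partial_x m=0,\\ &\partial_t m+\partial_x\Big(\frac{m^2}{\rho}\Big)+\partial_xP(\rho)+\partial_x(\mu(\rho)\partial_x\psi)=\beta\,\partial_x\Big(\mu(\rho)\partial_x\frac{m}{\rho}\Big),\\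 &\partial_t\phi+\frac12|\partial_x\psi|^2\mu'(\rho)-\frac{m^2}{\rho^2}\partial_x\psi+P'(\rho)\partial_x\psi+\frac{\delta}{\delta\rho}\mathcal{F}(\rho,m)=\beta\,\partial_x\psi\,\partial_x\Big(\frac{m}{\rho}\Big)\mu'(\rho)+\beta\frac{m}{\rho^2}\partial_x(\mu(\rho)\partial_x\psi),\\ &\partial_t\psi+2\,\partial_x\psi\,\frac{m}{\rho}+\partial_x\phi+\frac{\delta}{\delta m}\mathcal{F}(\rho,m)=-\beta\frac1\rho\partial_x(\mu(\rho)\partial_x\psi), \end{aligned}\right.$$ with initial and terminal conditions $$\rho(0,x)=\rho_0(x),\quad m(0,x)=m_0(x),\quad \frac{\delta}{\delta\rho_1}\mathcal{H}(\rho_1,m_1)(x)+\phi(1,x)=0,\quad \frac{\delta}{\delta m_1}\mathcal{H}(\rho_1,m_1)(x)+\psi(1,x)=0.$$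
   Context: $\mathbb{T}^1$ is the one-dimensional torus (periodic boundary conditions). All functions are smooth and $\rho>0$; $\mu',P'$ denote derivatives with respect to $\rho$. The functionals $\mathcal{F},\mathcal{H}$ have $L^2$ first variations: e.g. $\frac{\delta}{\delta\rho}\mathcal{F}(\rho,m)$ is the function on $\Omega$ with $\frac{d}{d\epsilon}\big|_{\epsilon=0}\mathcal{F}(\rho+\epsilon h,m)=\int_\Omega \frac{\delta}{\delta\rho}\mathcal{F}(\rho,m)\,h\,dx$ for all smooth $h$, and similarly for $m$ and for $\mathcal{H}$. Typical choices are $P(\rho)=\rho^\gamma$ and $\mu(\rho)=\rho^\alpha$ with $\gamma>1$, $\alpha\in\mathbb{R}$. Critical point: $(\rho,m,a)$ with $\rho(0,\cdot)=\rho_0$, $m(0,\cdot)=m_0$ is a critical point of the variational problem if there exist Lagrange multipliers $\phi,\psi\colon[0,1]\times\Omega\to\mathbb{R}$ such that all $L^2$ first variations (with respect to $\rho,m,a$, the terminal values $\rho_1,m_1$, and $\phi,\psi$, with the initial values held fixed) of the following Lagrangian vanish: $$\begin{aligned}\mathcal{L}=&\int_0^1\Big[\int_\Omega\tfrac12 a^2\mu(\rho)\,dx-\mathcal{F}(\rho,m)\Big]dt+\mathcal{H}(\rho_1,m_1)+\int_0^1\!\!\int_\Omega\phi\,(\partial_t\rho+\partial_xm)\,dx\,dt\\&+\int_0^1\!\!\int_\Omega\psi\Big(\partial_tm+\partial_x\big(\tfrac{m^2}{\rho}\big)+\partial_xP(\rho)+\partial_x(\mu(\rho)a)-\beta\partial_x\big(\mu(\rho)\partial_x\tfrac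 m\rho\big)\Big)dx\,dt.\end{aligned}$$ The critical point system is the system of equations characterizing such critical points. *)

theory Defs
  imports "HOL-Analysis.Analysis"
begin

section \<open>Smoothness\<close>

(* Intended for convex S with nonempty interior, where derivatives within S are unique;
   at boundary points they are one-sided. *)

primrec Ck_on :: "nat \<Rightarrow> 'a::euclidean_space set \<Rightarrow> ('a \<Rightarrow> real) \<Rightarrow> bool" where
  "Ck_on 0 S f \<longleftrightarrow> continuous_on S f"
| "Ck_on (Suc k) S f \<longleftrightarrow>
     f differentiable_on S \<and>
     (\<forall>v. Ck_on k S (\<lambda>x. frechet_derivative f (at x within S) v))"

definition smooth_on :: "'a::euclidean_space set \<Rightarrow> ('a \<Rightarrow> real) \<Rightarrow> bool" where
  "smooth_on S f \<longleftrightarrow> (\<forall>k. Ck_on k S f)"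

(* The torus is R/Z: functions on it are 1-periodic functions on the line, and the integral
   over it is the integral over {0..1}. *)

definition torus_smooth :: "(real \<Rightarrow> real) \<Rightarrow> bool" where
  "torus_smooth f \<longleftrightarrow> smooth_on UNIV f \<and> (\<forall>x. f (x + 1) = f x)"

definition smooth_family :: "'p::euclidean_space set \<Rightarrow> ('p \<Rightarrow> real \<Rightarrow> real) \<Rightarrow> bool" where
  "smooth_family S u \<longleftrightarrow>
     smooth_on (S \<times> UNIV) (\<lambda>(p, x). u p x) \<and> (\<forall>p\<in>S. \<forall>x. u p (x + 1) = u p x)"

abbreviation smooth_field :: "(real \<Rightarrow> real \<Rightarrow> real) \<Rightarrow> bool" where
  "smooth_field \<equiv> smooth_family {0..1}"

definition dt :: "(real \<Rightarrow> real \<Rightarrow> real) \<Rightarrow> real \<Rightarrow> real \<Rightarrow> real"  ("\<partial>\<^sub>t") where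
  "\<partial>\<^sub>t u t x = vector_derivative (\<lambda>s. u s x) (at t within {0..1})"

definition dx :: "(real \<Rightarrow> real \<Rightarrow> real) \<Rightarrow> real \<Rightarrow> real \<Rightarrow> real"  ("\<partial>\<^sub>x") where
  "\<partial>\<^sub>x u t x = deriv (u t) x"

section \<open>Functionals on the torus and their L2 first variations\<close>

definition has_L2_variation ::
  "((real \<Rightarrow> real) \<Rightarrow> real) \<Rightarrow> (real \<Rightarrow> real) \<Rightarrow> (real \<Rightarrow> real) \<Rightarrow> bool" where
  "has_L2_variation J u g \<longleftrightarrow> torus_smooth g \<and>
     (\<forall>h. torus_smooth h \<longrightarrow>
        ((\<lambda>\<epsilon>. J (\<lambda>x. u x + \<epsilon> * h x)) has_real_derivative
           integral {0..1} (\<lambda>x. g x * h x)) (at 0))"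

definition L2_variation :: "((real \<Rightarrow> real) \<Rightarrow> real) \<Rightarrow> (real \<Rightarrow> real) \<Rightarrow> real \<Rightarrow> real" where
  "L2_variation J u = (THE g. has_L2_variation J u g)"

type_synonym functional = "(real \<Rightarrow> real) \<Rightarrow> (real \<Rightarrow> real) \<Rightarrow> real"

definition var_rho :: "functional \<Rightarrow> (real \<Rightarrow> real) \<Rightarrow> (real \<Rightarrow> real) \<Rightarrow> real \<Rightarrow> real" where
  "var_rho F r m = L2_variation (\<lambda>r'. F r' m) r"

definition var_m :: "functional \<Rightarrow> (real \<Rightarrow> real) \<Rightarrow> (real \<Rightarrow> real) \<Rightarrow> real \<Rightarrow> real" where
  "var_m F r m = L2_variation (\<lambda>m'. F r m') m"

(* First conjunct: smoothness on the open set of pairs (r, m), r > 0, in the Frechet space of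
   pairs of smooth functions on the torus, tested along smooth families. By Boman's theorem it
   makes no difference whether the families have one, two or more parameters. *)

definition smooth_functional :: "functional \<Rightarrow> bool" where
  "smooth_functional F \<longleftrightarrow>
     (\<forall>a b c d :: real. \<forall>r m :: real \<times> real \<Rightarrow> real \<Rightarrow> real.
        a < b \<and> c < d \<and>
        smooth_family ({a..b} \<times> {c..d}) r \<and> smooth_family ({a..b} \<times> {c..d}) m \<and>
        (\<forall>p\<in>{a..b} \<times> {c..d}. \<forall>x. 0 < r p x) \<longrightarrow>
        smooth_on ({a..b} \<times> {c..d}) (\<lambda>p. F (r p) (m p))) \<and>
     (\<forall>r m. torus_smooth r \<and> torus_smooth m \<and> (\<forall>x. 0 < r x) \<longrightarrow>
        (\<exists>g. has_L2_variation (\<lambda>r'. F r' m) r g) \<and>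
        (\<exists>g. has_L2_variation (\<lambda>m'. F r m') m g))"

section \<open>The variational problem and its Lagrangian\<close>

definition objective ::
  "(real \<Rightarrow> real) \<Rightarrow> functional \<Rightarrow> functional \<Rightarrow>
   (real \<Rightarrow> real \<Rightarrow> real) \<Rightarrow> (real \<Rightarrow> real \<Rightarrow> real) \<Rightarrow> (real \<Rightarrow> real \<Rightarrow> real) \<Rightarrow> real" where
  "objective \<mu> F H \<rho> m a =
     integral {0..1} (\<lambda>t.
       integral {0..1} (\<lambda>x. 1/2 * (a t x)\<^sup>2 * \<mu> (\<rho> t x)) - F (\<rho> t) (m t))
     + H (\<rho> 1) (m 1)"

definition mass_residual ::
  "(real \<Rightarrow> real \<Rightarrow> real) \<Rightarrow> (real \<Rightarrow> real \<Rightarrow> real) \<Rightarrow> real \<Rightarrow> real \<Rightarrow> real" where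
  "mass_residual \<rho> m t x = \<partial>\<^sub>t \<rho> t x + \<partial>\<^sub>x m t x"

definition momentum_residual ::
  "real \<Rightarrow> (real \<Rightarrow> real) \<Rightarrow> (real \<Rightarrow> real) \<Rightarrow>
   (real \<Rightarrow> real \<Rightarrow> real) \<Rightarrow> (real \<Rightarrow> real \<Rightarrow> real) \<Rightarrow> (real \<Rightarrow> real \<Rightarrow> real) \<Rightarrow>
   real \<Rightarrow> real \<Rightarrow> real" where
  "momentum_residual \<beta> P \<mu> \<rho> m a t x =
     \<partial>\<^sub>t m t x
     + \<partial>\<^sub>x (\<lambda>t x. (m t x)\<^sup>2 / \<rho> t x) t x
     + \<partial>\<^sub>x (\<lambda>t x. P (\<rho> t x)) t x
     + \<partial>\<^sub>x (\<lambda>t x. \<mu> (\<rho> t x) * a t x) t x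
     - \<beta> * \<partial>\<^sub>x (\<lambda>t x. \<mu> (\<rho> t x) * \<partial>\<^sub>x (\<lambda>t x. m t x / \<rho> t x) t x) t x"

definition lagrangian ::
  "real \<Rightarrow> (real \<Rightarrow> real) \<Rightarrow> (real \<Rightarrow> real) \<Rightarrow> functional \<Rightarrow> functional \<Rightarrow>
   (real \<Rightarrow> real \<Rightarrow> real) \<Rightarrow> (real \<Rightarrow> real \<Rightarrow> real) \<Rightarrow> (real \<Rightarrow> real \<Rightarrow> real) \<Rightarrow>
   (real \<Rightarrow> real \<Rightarrow> real) \<Rightarrow> (real \<Rightarrow> real \<Rightarrow> real) \<Rightarrow> real" where
  "lagrangian \<beta> P \<mu> F H \<rho> m a \<phi> \<psi> =
     objective \<mu> F H \<rho> m a
     + integral {0..1} (\<lambda>t. integral {0..1} (\<lambda>x. \<phi> t x * mass_residual \<rho> m t x))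
     + integral {0..1} (\<lambda>t. integral {0..1} (\<lambda>x. \<psi> t x * momentum_residual \<beta> P \<mu> \<rho> m a t x))"

section \<open>Critical points\<close>

definition has_field_variation ::
  "((real \<Rightarrow> real \<Rightarrow> real) \<Rightarrow> real) \<Rightarrow> (real \<Rightarrow> real \<Rightarrow> real) \<Rightarrow> (real \<Rightarrow> real \<Rightarrow> real) \<Rightarrow> bool" where
  "has_field_variation J u g \<longleftrightarrow>
     (\<forall>h. smooth_field h \<longrightarrow>
        ((\<lambda>\<epsilon>. J (\<lambda>t x. u t x + \<epsilon> * h t x)) has_real_derivative
           integral {0..1} (\<lambda>t. integral {0..1} (\<lambda>x. g t x * h t x))) (at 0))"

(* For a state variable u whose initial value is held fixed: the perturbations vanish at time 0,
   g is the first variation with respect to u, and g1 the one with respect to the terminal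
   value u 1. *)

definition has_state_variation ::
  "((real \<Rightarrow> real \<Rightarrow> real) \<Rightarrow> real) \<Rightarrow> (real \<Rightarrow> real \<Rightarrow> real) \<Rightarrow>
   (real \<Rightarrow> real \<Rightarrow> real) \<Rightarrow> (real \<Rightarrow> real) \<Rightarrow> bool" where
  "has_state_variation J u g g1 \<longleftrightarrow>
     (\<forall>h. smooth_field h \<and> (\<forall>x. h 0 x = 0) \<longrightarrow>
        ((\<lambda>\<epsilon>. J (\<lambda>t x. u t x + \<epsilon> * h t x)) has_real_derivative
           integral {0..1} (\<lambda>t. integral {0..1} (\<lambda>x. g t x * h t x))
           + integral {0..1} (\<lambda>x. g1 x * h 1 x)) (at 0))"

definition critical_point ::
  "real \<Rightarrow> (real \<Rightarrow> real) \<Rightarrow> (real \<Rightarrow> real) \<Rightarrow> functional \<Rightarrow> functional \<Rightarrow>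
   (real \<Rightarrow> real) \<Rightarrow> (real \<Rightarrow> real) \<Rightarrow>
   (real \<Rightarrow> real \<Rightarrow> real) \<Rightarrow> (real \<Rightarrow> real \<Rightarrow> real) \<Rightarrow> (real \<Rightarrow> real \<Rightarrow> real) \<Rightarrow> bool" where
  "critical_point \<beta> P \<mu> F H \<rho>0 m0 \<rho> m a \<longleftrightarrow>
     (\<forall>x. \<rho> 0 x = \<rho>0 x) \<and> (\<forall>x. m 0 x = m0 x) \<and>
     (\<exists>\<phi> \<psi>. smooth_field \<phi> \<and> smooth_field \<psi> \<and>
        has_state_variation (\<lambda>r. lagrangian \<beta> P \<mu> F H r m a \<phi> \<psi>) \<rho> (\<lambda>_ _. 0) (\<lambda>_. 0) \<and>
        has_state_variation (\<lambda>n. lagrangian \<beta> P \<mu> F H \<rho> n a \<phi> \<psi>) m (\<lambda>_ _. 0) (\<lambda>_. 0) \<and>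
        has_field_variation (\<lambda>b. lagrangian \<beta> P \<mu> F H \<rho> m b \<phi> \<psi>) a (\<lambda>_ _. 0) \<and>
        has_field_variation (\<lambda>p. lagrangian \<beta> P \<mu> F H \<rho> m a p \<psi>) \<phi> (\<lambda>_ _. 0) \<and>
        has_field_variation (\<lambda>q. lagrangian \<beta> P \<mu> F H \<rho> m a \<phi> q) \<psi> (\<lambda>_ _. 0))"

end

(* Integrating by parts in x turns the Lagrangian into H - int F + int int of a density in the values
   and first derivatives of the fields. Differentiating under the integral sign along a perturbation
   and integrating by parts in t and x expresses each first variation as the pairing of the
   perturbation with an Euler-Lagrange expression, plus the pairing of its terminal value with
   the variation of H plus the multiplier. Such a pairing vanishes for all perturbations exactly when
   both factors vanish: separated perturbations theta(t) eta(x) with theta a polynomial localise in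
   time by Weierstrass approximation, after which eta is taken to be the expression itself at a
   fixed time. So the contribution of F only has to be smooth in x and weakly continuous in t. *)

theory Submission
  imports Defs
begin

text \<open>\<open>P\<close> and \<open>\<mu>\<close> are smooth only on positive densities, so the
  perturbation parameter has to be bounded uniformly; periodicity and compactness give such a bound.
  Within it all five fields are perturbed at once and the derivative is computed a single time; each
  first variation results by setting the other perturbations to zero. The computation is pointwise
  because the weak density is an explicit function of finitely many real numbers, all affine in
  \<epsilon>. Its derivative minus the Euler-Lagrange pairing is exactly a time derivative plus a
  space derivative, so integration by parts reduces to one algebraic identity. The functionals are
  the other obstacle: their first variations are given at each time separately, with no assumed
  regularity in time. Smoothness along two-parameter families makes up for this, with \<epsilon> and
  time as parameters: the \<epsilon>-derivative at 0 of a jointly smooth function is continuous in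
  time, and it equals the pairing with the variation.\<close>

section \<open>Calculus of smooth functions\<close>

(* Sufficient for derivatives within S to be unique: every point of S is approached inside S
   along each coordinate direction. *)
definition fat :: "'a::euclidean_space set \<Rightarrow> bool" where
  "fat S \<longleftrightarrow> (\<forall>x\<in>S. \<forall>i\<in>Basis. \<forall>e>0. \<exists>d. 0 < \<bar>d\<bar> \<and> \<bar>d\<bar> < e \<and> x + d *\<^sub>R i \<in> S)"

lemma fat_open: "open S \<Longrightarrow> fat S"
  unfolding fat_def
proof (intro ballI allI impI)
  fix x i :: 'a and e :: real
  assume S: "open S" "x \<in> S" and i: "i \<in> Basis" and e: "0 < e"
  then obtain r where r: "r > 0" "ball x r \<subseteq> S" using openE by blast
  have "x + (min r e / 2) *\<^sub>R i \<in> ball x r"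
    using i r e by (auto simp: dist_norm)
  then show "\<exists>d. 0 < \<bar>d\<bar> \<and> \<bar>d\<bar> < e \<and> x + d *\<^sub>R i \<in> S"
    using r e by (intro exI[of _ "min r e / 2"]) auto
qed

lemma fat_UNIV [simp]: "fat UNIV" and fat_greaterThan [simp]: "fat {c<..}" for c :: real
  by (auto intro: fat_open)

lemma fat_interval [simp]:
  fixes a b :: real
  assumes "a < b"
  shows "fat {a..b}"
  unfolding fat_def
proof (intro ballI allI impI)
  fix x i e :: real
  assume x: "x \<in> {a..b}" and i: "i \<in> Basis" and e: "e > 0"
  show "\<exists>d. 0 < \<bar>d\<bar> \<and> \<bar>d\<bar> < e \<and> x + d *\<^sub>R i \<in> {a..b}"
  proof (cases "x = b")
    case True
    then show ?thesis using assms e i by (intro exI[of _ "- (min e (b - a) / 2)"]) (auto simp: min_def field_simps)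
  next
    case False
    then show ?thesis using assms e i x by (intro exI[of _ "min e (b - x) / 2"]) (auto simp: min_def field_simps)
  qed
qed

lemma fat_Times [simp]:
  assumes "fat S" "fat T"
  shows "fat (S \<times> T)"
  unfolding fat_def
proof (intro ballI allI impI)
  fix x i :: "'a \<times> 'b" and e :: real
  assume x: "x \<in> S \<times> T" and i: "i \<in> Basis" and e: "e > 0"
  from i consider j where "j \<in> Basis" "i = (j, 0)" | j where "j \<in> Basis" "i = (0, j)"
    by (auto simp: Basis_prod_def)
  then show "\<exists>d. 0 < \<bar>d\<bar> \<and> \<bar>d\<bar> < e \<and> x + d *\<^sub>R i \<in> S \<times> T"
  proof cases
    case 1
    then show ?thesis using assms(1)[unfolded fat_def, rule_format, of "fst x" j e] x e
      by (cases x) auto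
  next
    case 2
    then show ?thesis using assms(2)[unfolded fat_def, rule_format, of "snd x" j e] x e
      by (cases x) auto
  qed
qed

text \<open>\<open>frechet_derivative\<close> is a choice operator; uniqueness within a fat set
  identifies it with any derivative found by the usual rules.\<close>

lemma fat_frechet_derivative:
  assumes "fat S" "x \<in> S" "(f has_derivative f') (at x within S)"
  shows "frechet_derivative f (at x within S) = f'"
proof (rule frechet_derivative_unique_within[OF _ assms(3)])
  show "(f has_derivative frechet_derivative f (at x within S)) (at x within S)"
    using assms(3) differentiableI frechet_derivative_works by blast
qed (use assms in \<open>auto simp: fat_def\<close>)

section \<open>Differentiability of finite order and its closure rules\<close>

lemma differentiable_on_has_derivative:
  assumes "f differentiable_on S" "x \<in> S"
  shows "(f has_derivative frechet_derivative f (at x within S)) (at x within S)"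
  using assms frechet_derivative_works unfolding differentiable_on_def by blast

text \<open>A computed derivative matches \<open>frechet_derivative\<close> only at points of
  \<open>S\<close>, so regularity must be insensitive to values outside \<open>S\<close>.\<close>

lemma Ck_on_cong:
  assumes "fat S" "\<And>x. x \<in> S \<Longrightarrow> f x = g x" "Ck_on k S f"
  shows "Ck_on k S g"
  using assms(2,3)
proof (induction k arbitrary: f g)
  case 0
  then show ?case using continuous_on_cong[of S S f g] by simp
next
  case (Suc k)
  have D: "(g has_derivative frechet_derivative f (at x within S)) (at x within S)" if "x \<in> S" for x
    using differentiable_on_has_derivative[of f S x] Suc.prems that
    by (auto intro: has_derivative_transform[of x S g f])
  show ?case
    unfolding Ck_on.simps
  proof (intro conjI allI)
    show "g differentiable_on S"
      using D unfolding differentiable_on_def differentiable_def by blast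
    fix v
    show "Ck_on k S (\<lambda>x. frechet_derivative g (at x within S) v)"
    proof (rule Suc.IH)
      show "Ck_on k S (\<lambda>x. frechet_derivative f (at x within S) v)"
        using Suc.prems by simp
    qed (use fat_frechet_derivative[OF assms(1) _ D] in simp)
  qed
qed

text \<open>The working form of the recursive definition: an explicit candidate \<open>f'\<close>
  replaces the chosen derivative, so a closure rule reduces to a derivative rule and the induction
  hypothesis.\<close>

lemma Ck_on_SucI:
  assumes "fat S" "\<And>x. x \<in> S \<Longrightarrow> (f has_derivative f' x) (at x within S)"
    and "\<And>v. Ck_on k S (\<lambda>x. f' x v)"
  shows "Ck_on (Suc k) S f"
  unfolding Ck_on.simps
proof (intro conjI allI)
  show "f differentiable_on S"
    using assms(2) unfolding differentiable_on_def differentiable_def by blast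
  show "Ck_on k S (\<lambda>x. frechet_derivative f (at x within S) v)" for v
    using Ck_on_cong[OF assms(1) _ assms(3)[of v]] fat_frechet_derivative[OF assms(1) _ assms(2)]
    by simp
qed

text \<open>The product and chain rules keep undifferentiated factors, whose order must be lowered
  to fit the induction hypothesis.\<close>

lemma Ck_on_Suc_imp: "Ck_on (Suc k) S f \<Longrightarrow> Ck_on k S f"
  by (induction k arbitrary: f) (auto simp: differentiable_imp_continuous_on)

lemma Ck_on_const: "fat S \<Longrightarrow> Ck_on k S (\<lambda>_. c)"
proof (induction k arbitrary: c)
  case (Suc k)
  then show ?case by (intro Ck_on_SucI[where f' = "\<lambda>_ _. 0"]) auto
qed simp

lemma Ck_on_bounded_linear:
  assumes "fat S" "bounded_linear f"
  shows "Ck_on k S f"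
proof (cases k)
  case 0
  then show ?thesis using assms by (simp add: linear_continuous_on)
next
  case (Suc j)
  then show ?thesis
    using assms by (auto intro!: Ck_on_SucI[where f' = "\<lambda>_. f"] Ck_on_const bounded_linear_imp_has_derivative simp del: Ck_on.simps)
qed

lemma Ck_on_add:
  assumes "fat S" "Ck_on k S f" "Ck_on k S g"
  shows "Ck_on k S (\<lambda>x. f x + g x)"
  using assms(2,3)
proof (induction k arbitrary: f g)
  case 0
  then show ?case by (simp add: continuous_on_add)
next
  case (Suc k)
  show ?case
    by (rule Ck_on_SucI[OF assms(1)], rule has_derivative_add;
        (rule differentiable_on_has_derivative | rule Suc.IH)) (use Suc.prems in auto)
qed

lemma Ck_on_mult:
  assumes "fat S" "Ck_on k S f" "Ck_on k S g"
  shows "Ck_on k S (\<lambda>x. f x * g x)"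
  using assms(2,3)
proof (induction k arbitrary: f g)
  case 0
  then show ?case by (simp add: continuous_on_mult)
next
  case (Suc k)
  have "Ck_on k S f" "Ck_on k S g"
    using Suc.prems Ck_on_Suc_imp by blast+
  moreover have "\<And>v. Ck_on k S (\<lambda>x. frechet_derivative f (at x within S) v)"
    "\<And>v. Ck_on k S (\<lambda>x. frechet_derivative g (at x within S) v)"
    using Suc.prems by auto
  ultimately have "Ck_on k S (\<lambda>x. f x * frechet_derivative g (at x within S) v
      + frechet_derivative f (at x within S) v * g x)" for v
    by (intro Ck_on_add[OF assms(1)] Suc.IH)
  moreover have "((\<lambda>x. f x * g x) has_derivative (\<lambda>v. f x * frechet_derivative g (at x within S) v
      + frechet_derivative f (at x within S) v * g x)) (at x within S)" if "x \<in> S" for x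
    using Suc.prems that by (intro has_derivative_mult differentiable_on_has_derivative) auto
  ultimately show ?case
    by (intro Ck_on_SucI[OF assms(1)])
qed

lemma Ck_on_compose:
  fixes g :: "real \<Rightarrow> real"
  assumes "fat S" "Ck_on k T g" "Ck_on k S f" "f ` S \<subseteq> T"
  shows "Ck_on k S (\<lambda>x. g (f x))"
  using assms(2,3)
proof (induction k arbitrary: g)
  case 0
  then show ?case using assms(4) continuous_on_compose2[of T g S f] by simp
next
  case (Suc k)
  let ?f' = "\<lambda>x. frechet_derivative f (at x within S)"
  let ?g' = "\<lambda>y. frechet_derivative g (at y within T)"
  have g: "(g has_derivative ?g' y) (at y within T)" if "y \<in> T" for y
    using differentiable_on_has_derivative[of g T y] Suc.prems that by auto
  have D: "((\<lambda>x. g (f x)) has_derivative (\<lambda>v. ?g' (f x) 1 * ?f' x v)) (at x within S)" if x: "x \<in> S" for x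
  proof -
    have fx: "f x \<in> T" using x assms(4) by blast
    have 1: "((\<lambda>x. g (f x)) has_derivative (\<lambda>v. ?g' (f x) (?f' x v))) (at x within S)"
    proof (rule has_derivative_in_compose[where f = f and f' = "?f' x" and g = g and g' = "?g' (f x)"])
      show "(f has_derivative ?f' x) (at x within S)"
        using differentiable_on_has_derivative[of f S x] Suc.prems x by auto
      show "(g has_derivative ?g' (f x)) (at (f x) within f ` S)"
        by (rule has_derivative_subset[OF g[OF fx] assms(4)])
    qed
    \<comment> \<open>A linear map on the line is multiplication by its value at 1. The outer
      derivative thus becomes a scalar function, to which the induction hypothesis applies.\<close>
    have 2: "(\<lambda>v. ?g' (f x) (?f' x v)) = (\<lambda>v. ?g' (f x) 1 * ?f' x v)"
    proof
      show "?g' (f x) (?f' x v) = ?g' (f x) 1 * ?f' x v" for v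
        using linear_cmul[OF has_derivative_linear[OF g[OF fx]], of "?f' x v" 1]
        by (simp only: real_scaleR_def mult_1_right mult_1_left mult.commute)
    qed
    show ?thesis using 1 unfolding 2 .
  qed
  have "Ck_on k S (\<lambda>x. ?g' (f x) 1 * ?f' x v)" for v
  proof (rule Ck_on_mult[OF assms(1)])
    show "Ck_on k S (\<lambda>x. ?g' (f x) 1)"
    proof (rule Suc.IH)
      show "Ck_on k T (\<lambda>y. ?g' y 1)"
        using Suc.prems(1) by simp
      show "Ck_on k S f"
        using Suc.prems(2) by (rule Ck_on_Suc_imp)
    qed
    show "Ck_on k S (\<lambda>x. ?f' x v)"
      using Suc.prems by simp
  qed
  then show ?case
    using D by (intro Ck_on_SucI[OF assms(1)])
qed

text \<open>Complements \<open>Ck_on_compose\<close>, whose outer function lives on the line. The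
  derivative in direction \<open>v\<close> is a derivative of \<open>g\<close> in direction
  \<open>L v\<close> under the same substitution, so the induction closes directly. Slices,
  projections and regroupings of coordinates are instances.\<close>

lemma Ck_on_linear_reparam:
  assumes "fat S" "bounded_linear L" "\<And>x. x \<in> S \<Longrightarrow> c + L x \<in> T" "Ck_on k T g"
  shows "Ck_on k S (\<lambda>x. g (c + L x))"
  using assms(4)
proof (induction k arbitrary: g)
  case 0
  have "continuous_on S (\<lambda>x. c + L x)"
    using assms(2) by (intro continuous_intros linear_continuous_on)
  then show ?case using 0 assms(3) continuous_on_compose2[of T g S "\<lambda>x. c + L x"] by auto
next
  case (Suc k)
  show ?case
  proof (rule Ck_on_SucI[OF assms(1)])
    fix x assume x: "x \<in> S"
    show "((\<lambda>x. g (c + L x)) has_derivative (\<lambda>v. frechet_derivative g (at (c + L x) within T) (L v))) (at x within S)"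
    proof (rule has_derivative_in_compose[where g = g])
      show "((\<lambda>x. c + L x) has_derivative L) (at x within S)"
        using assms(2) by (auto intro!: derivative_eq_intros bounded_linear_imp_has_derivative)
      show "(g has_derivative frechet_derivative g (at (c + L x) within T)) (at (c + L x) within (\<lambda>x. c + L x) ` S)"
        using assms(3) x Suc.prems by (intro has_derivative_subset[OF differentiable_on_has_derivative]) auto
    qed
  next
    show "Ck_on k S (\<lambda>x. frechet_derivative g (at (c + L x) within T) (L v))" for v
      using Suc.prems by (intro Suc.IH) auto
  qed
qed

text \<open>The derivative is a polynomial in \<open>inverse\<close> itself, so closure under
  products carries the induction.\<close>

lemma Ck_on_inverse: "Ck_on k {0<..} (inverse :: real \<Rightarrow> real)"
proof (induction k)
  case 0
  then show ?case by (auto intro!: continuous_on_inverse continuous_on_id)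
next
  case (Suc k)
  show ?case
  proof (rule Ck_on_SucI[where f' = "\<lambda>x v. - (inverse x * inverse x) * v"])
    show "(inverse has_derivative (\<lambda>v. - (inverse x * inverse x) * v)) (at x within {0<..})" if "x \<in> {0<..}" for x :: real
      using that by (auto intro!: derivative_eq_intros)
    show "Ck_on k {0<..} (\<lambda>x. - (inverse x * inverse x) * v)" for v :: real
      using Ck_on_mult[OF _ Ck_on_mult[OF _ Suc Suc] Ck_on_const[of "{0<..}" k "-v"]] by simp
  qed simp
qed

section \<open>Smooth functions: passage from every finite order\<close>

lemma smooth_on_cong:
  "fat S \<Longrightarrow> smooth_on S f \<Longrightarrow> (\<And>x. x \<in> S \<Longrightarrow> f x = g x) \<Longrightarrow> smooth_on S g"
  unfolding smooth_on_def using Ck_on_cong by blast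

lemma smooth_on_continuous: "smooth_on S f \<Longrightarrow> continuous_on S f"
  unfolding smooth_on_def by (metis Ck_on.simps(1))

lemma smooth_on_has_derivative:
  "smooth_on S f \<Longrightarrow> x \<in> S \<Longrightarrow> (f has_derivative frechet_derivative f (at x within S)) (at x within S)"
  unfolding smooth_on_def by (metis Ck_on.simps(2) differentiable_on_has_derivative)

lemma smooth_on_frechet_derivative:
  "smooth_on S f \<Longrightarrow> smooth_on S (\<lambda>x. frechet_derivative f (at x within S) v)"
  unfolding smooth_on_def by (metis Ck_on.simps(2))

named_theorems smooth_intros

lemma smooth_on_const [smooth_intros]: "fat S \<Longrightarrow> smooth_on S (\<lambda>_. c)"
  unfolding smooth_on_def using Ck_on_const by blast

lemma smooth_on_bounded_linear: "fat S \<Longrightarrow> bounded_linear f \<Longrightarrow> smooth_on S f"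
  unfolding smooth_on_def using Ck_on_bounded_linear by blast

lemma smooth_on_add [smooth_intros]:
  "fat S \<Longrightarrow> smooth_on S f \<Longrightarrow> smooth_on S g \<Longrightarrow> smooth_on S (\<lambda>x. f x + g x)"
  unfolding smooth_on_def using Ck_on_add by blast

lemma smooth_on_mult [smooth_intros]:
  "fat S \<Longrightarrow> smooth_on S f \<Longrightarrow> smooth_on S g \<Longrightarrow> smooth_on S (\<lambda>x. f x * g x)"
  unfolding smooth_on_def using Ck_on_mult by blast

lemma smooth_on_diff [smooth_intros]:
  assumes "fat S" "smooth_on S f" "smooth_on S g"
  shows "smooth_on S (\<lambda>x. f x - g x)"
  using smooth_on_add[OF assms(1,2) smooth_on_mult[OF assms(1) smooth_on_const[OF assms(1), of "-1"] assms(3)]]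
  by simp

lemma smooth_on_power2 [smooth_intros]:
  "fat S \<Longrightarrow> smooth_on S f \<Longrightarrow> smooth_on S (\<lambda>x. (f x)\<^sup>2)"
  unfolding power2_eq_square by (rule smooth_on_mult)

lemma smooth_on_compose:
  fixes g :: "real \<Rightarrow> real"
  assumes "fat S" "smooth_on T g" "smooth_on S f" "\<And>x. x \<in> S \<Longrightarrow> f x \<in> T"
  shows "smooth_on S (\<lambda>x. g (f x))"
  using assms Ck_on_compose[of S _ T g f] unfolding smooth_on_def by blast

lemma smooth_on_divide [smooth_intros]:
  assumes "fat S" "smooth_on S f" "smooth_on S g" "\<And>x. x \<in> S \<Longrightarrow> 0 < g x"
  shows "smooth_on S (\<lambda>x. f x / g x)"
proof -
  have "smooth_on {0<..} (inverse :: real \<Rightarrow> real)"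
    unfolding smooth_on_def using Ck_on_inverse by blast
  then have "smooth_on S (\<lambda>x. inverse (g x))"
    using smooth_on_compose[of S "{0<..}" inverse g] assms by auto
  then show ?thesis
    unfolding divide_inverse using assms smooth_on_mult by blast
qed

lemma smooth_on_linear_reparam:
  assumes "fat S" "smooth_on T g" "bounded_linear L" "\<And>x. x \<in> S \<Longrightarrow> c + L x \<in> T"
  shows "smooth_on S (\<lambda>x. g (c + L x))"
  using assms Ck_on_linear_reparam[of S L c T _ g] unfolding smooth_on_def by blast

lemma smooth_on_reparam:
  assumes "fat S" "smooth_on T g" "bounded_linear L" "\<And>x. x \<in> S \<Longrightarrow> L x \<in> T"
  shows "smooth_on S (\<lambda>x. g (L x))"
  using smooth_on_linear_reparam[OF assms(1-3), of 0] assms(4) by simp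

text \<open>Links the one-variable \<open>deriv\<close>, in which the system states the derivatives
  of \<open>P\<close> and \<open>\<mu>\<close>, to the Frechet derivatives that define
  smoothness.\<close>

lemma smooth_on_deriv:
  fixes f :: "real \<Rightarrow> real"
  assumes "open S" "smooth_on S f"
  shows "smooth_on S (deriv f)" and "x \<in> S \<Longrightarrow> (f has_real_derivative deriv f x) (at x)"
proof -
  have D: "(f has_real_derivative frechet_derivative f (at x within S) 1) (at x)" if "x \<in> S" for x
  proof -
    have F: "(f has_derivative frechet_derivative f (at x within S)) (at x)"
      using smooth_on_has_derivative[OF assms(2) that] at_within_open[OF that assms(1)] by simp
    show ?thesis
    proof (rule has_derivative_imp_has_field_derivative[OF F])
      show "v * frechet_derivative f (at x within S) 1 = frechet_derivative f (at x within S) v" for v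
        using linear_cmul[OF has_derivative_linear[OF F], of v 1] by simp
    qed
  qed
  show "smooth_on S (deriv f)"
    using smooth_on_cong[OF fat_open[OF assms(1)] smooth_on_frechet_derivative[OF assms(2), of 1]]
      DERIV_imp_deriv[OF D] by simp
  show "(f has_real_derivative deriv f x) (at x)" if "x \<in> S"
    using D DERIV_imp_deriv that by fastforce
qed

section \<open>Restriction, slices and differentiation under the integral sign\<close>

lemma smooth_on_subset: "fat S \<Longrightarrow> smooth_on T f \<Longrightarrow> S \<subseteq> T \<Longrightarrow> smooth_on S f"
  using smooth_on_reparam[of S T f "\<lambda>x. x"] by (auto simp: bounded_linear_ident)

text \<open>A partial derivative is the Frechet derivative in direction \<open>(1, 0)\<close>. It
  serves twice: for the perturbation parameter \<epsilon> and for time.\<close>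

lemma smooth_on_slice:
  fixes f :: "real \<times> 'b::euclidean_space \<Rightarrow> real"
  assumes "smooth_on (U \<times> T) f" "e \<in> U" "z \<in> T"
  shows "((\<lambda>e. f (e, z)) has_real_derivative frechet_derivative f (at (e, z) within U \<times> T) (1, 0)) (at e within U)"
proof -
  let ?D = "frechet_derivative f (at (e, z) within U \<times> T)"
  have D: "(f has_derivative ?D) (at (e, z) within U \<times> T)"
    using assms by (intro smooth_on_has_derivative) auto
  have "((\<lambda>e. f (e, z)) has_derivative (\<lambda>v. ?D (v, 0))) (at e within U)"
  proof (rule has_derivative_in_compose[where f = "\<lambda>e. (e, z)" and f' = "\<lambda>v. (v, 0)" and g = f and g' = ?D])
    show "((\<lambda>e. (e, z)) has_derivative (\<lambda>v. (v, 0))) (at e within U)"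
      by (auto intro!: derivative_eq_intros)
    show "(f has_derivative ?D) (at (e, z) within (\<lambda>e. (e, z)) ` U)"
      using assms(3) by (intro has_derivative_subset[OF D]) auto
  qed
  then show ?thesis
  proof (rule has_derivative_imp_has_field_derivative)
    show "v * ?D (1, 0) = ?D (v, 0)" for v
      using linear_cmul[OF has_derivative_linear[OF D], of v "(1, 0)"] by simp
  qed
qed

text \<open>The hypothesis on \<open>D\<close> is pointwise, but joint smoothness of
  \<open>K\<close> makes \<open>D\<close> agree with a continuous partial derivative. This permits
  the Leibniz rule and yields the continuity of \<open>D\<close>, which for the functionals is the
  source of continuity in time.\<close>

lemma has_derivative_integral_smooth:
  fixes K :: "real \<Rightarrow> 'b::euclidean_space \<Rightarrow> real"
  assumes "0 < e" "fat (cbox a b)"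
    and K: "smooth_on ({-e..e} \<times> cbox a b) (\<lambda>w. K (fst w) (snd w))"
    and D: "\<And>z. z \<in> cbox a b \<Longrightarrow> ((\<lambda>\<epsilon>. K \<epsilon> z) has_real_derivative D z) (at 0)"
  shows "((\<lambda>\<epsilon>. integral (cbox a b) (K \<epsilon>)) has_real_derivative integral (cbox a b) D) (at 0)"
    and "continuous_on (cbox a b) D"
proof -
  let ?f = "\<lambda>w. K (fst w) (snd w)"
  define K' where "K' \<epsilon> z = frechet_derivative ?f (at (\<epsilon>, z) within {-e..e} \<times> cbox a b) (1, 0)" for \<epsilon> z
  \<comment> \<open>0 is interior to the parameter interval, so derivatives within the interval are
    two-sided there.\<close>
  have at0: "at (0::real) within {-e..e} = at 0"
    using assms(1) by (intro at_within_interior) auto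
  have cont: "continuous_on ({-e..e} \<times> cbox a b) (\<lambda>(\<epsilon>, z). K' \<epsilon> z)"
    unfolding K'_def case_prod_unfold prod.collapse
    by (rule smooth_on_continuous[OF smooth_on_frechet_derivative[OF K]])
  have K': "((\<lambda>\<epsilon>. K \<epsilon> z) has_real_derivative K' \<epsilon> z) (at \<epsilon> within {-e..e})"
    if "\<epsilon> \<in> {-e..e}" "z \<in> cbox a b" for \<epsilon> z
    using smooth_on_slice[OF K that] unfolding K'_def by simp
  have D_eq: "K' 0 z = D z" if "z \<in> cbox a b" for z
    using DERIV_unique[OF _ D[OF that]] K'[of 0 z] that assms(1) at0 by auto
  have "((\<lambda>\<epsilon>. integral (cbox a b) (K \<epsilon>)) has_real_derivative integral (cbox a b) (K' 0)) (at 0 within {-e..e})"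
  proof (rule leibniz_rule_field_derivative[OF K' _ cont])
    fix \<epsilon> assume "\<epsilon> \<in> {-e..e}"
    then show "K \<epsilon> integrable_on cbox a b"
      by (intro integrable_continuous continuous_on_compose2[OF smooth_on_continuous[OF K], of _ "\<lambda>z. (\<epsilon>, z)", simplified] continuous_intros) auto
  qed (use assms(1) in auto)
  moreover have "integral (cbox a b) (K' 0) = integral (cbox a b) D"
    by (intro integral_cong D_eq)
  ultimately show "((\<lambda>\<epsilon>. integral (cbox a b) (K \<epsilon>)) has_real_derivative integral (cbox a b) D) (at 0)"
    using at0 by simp
  have "continuous_on (cbox a b) (\<lambda>z. K' (fst (0::real, z)) (snd (0::real, z)))"
    by (rule continuous_on_compose2[OF cont[unfolded case_prod_unfold], of _ "\<lambda>z. (0, z)"])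
      (use assms(1) in \<open>auto intro!: continuous_intros\<close>)
  then show "continuous_on (cbox a b) D"
    using D_eq continuous_on_cong[of "cbox a b" "cbox a b" "K' 0" D] by simp
qed

section \<open>Smooth fields\<close>

lemma fat_strip [simp]: "fat ({0..1::real} \<times> (UNIV :: real set))"
  by simp

lemma smooth_family_iff:
  "smooth_family S u \<longleftrightarrow> smooth_on (S \<times> UNIV) (\<lambda>z. u (fst z) (snd z)) \<and> (\<forall>p\<in>S. \<forall>x. u p (x + 1) = u p x)"
  unfolding smooth_family_def case_prod_unfold ..

lemma smooth_field_smooth_on: "smooth_field u \<Longrightarrow> smooth_on ({0..1} \<times> UNIV) (\<lambda>z. u (fst z) (snd z))"
  by (simp add: smooth_family_iff)

lemma smooth_field_periodic: "smooth_field u \<Longrightarrow> t \<in> {0..1} \<Longrightarrow> u t (x + 1) = u t x"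
  by (simp add: smooth_family_iff)

section \<open>Closure of smooth fields under algebraic operations\<close>

named_theorems field_intros

lemma smooth_field_const [field_intros]: "smooth_field (\<lambda>_ _. c)"
  by (simp add: smooth_family_iff smooth_on_const)

lemma smooth_field_add [field_intros]:
  "smooth_field u \<Longrightarrow> smooth_field v \<Longrightarrow> smooth_field (\<lambda>t x. u t x + v t x)"
  by (simp add: smooth_family_iff smooth_on_add)

lemma smooth_field_diff [field_intros]:
  "smooth_field u \<Longrightarrow> smooth_field v \<Longrightarrow> smooth_field (\<lambda>t x. u t x - v t x)"
  by (simp add: smooth_family_iff smooth_on_diff)

lemma smooth_field_mult [field_intros]:
  "smooth_field u \<Longrightarrow> smooth_field v \<Longrightarrow> smooth_field (\<lambda>t x. u t x * v t x)"
  by (simp add: smooth_family_iff smooth_on_mult)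

lemma smooth_field_power2 [field_intros]:
  "smooth_field u \<Longrightarrow> smooth_field (\<lambda>t x. (u t x)\<^sup>2)"
  by (simp add: smooth_family_iff smooth_on_power2)

lemma smooth_field_divide [field_intros]:
  "smooth_field u \<Longrightarrow> smooth_field v \<Longrightarrow> (\<And>t x. t \<in> {0..1} \<Longrightarrow> 0 < v t x) \<Longrightarrow> smooth_field (\<lambda>t x. u t x / v t x)"
  by (auto simp: smooth_family_iff intro!: smooth_on_divide)

lemma smooth_field_compose:
  assumes "smooth_on {0<..} g" "smooth_field u" "\<And>t x. t \<in> {0..1} \<Longrightarrow> 0 < u t x"
  shows "smooth_field (\<lambda>t x. g (u t x))"
proof -
  have "smooth_on ({0..1} \<times> UNIV) (\<lambda>z. g (u (fst z) (snd z)))"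
    using assms by (intro smooth_on_compose[OF fat_strip assms(1) smooth_field_smooth_on]) auto
  then show ?thesis
    using assms(2) by (simp add: smooth_family_iff)
qed

section \<open>Partial derivatives of smooth fields\<close>

lemma smooth_field_dx_aux:
  assumes "smooth_field u" "t \<in> {0..1}"
  shows "(u t has_real_derivative
    frechet_derivative (\<lambda>z. u (fst z) (snd z)) (at (t, x) within {0..1} \<times> UNIV) (0, 1)) (at x)"
proof -
  let ?f = "\<lambda>z. u (fst z) (snd z)"
  let ?D = "frechet_derivative ?f (at (t, x) within {0..1} \<times> UNIV)"
  have D: "(?f has_derivative ?D) (at (t, x) within {0..1} \<times> UNIV)"
    using assms smooth_field_smooth_on by (intro smooth_on_has_derivative) auto
  have "((\<lambda>x. ?f (t, x)) has_derivative (\<lambda>v. ?D (0, v))) (at x)"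
  proof (rule has_derivative_in_compose[where f = "\<lambda>x. (t, x)" and f' = "\<lambda>v. (0, v)" and g = ?f and g' = ?D])
    show "((\<lambda>x. (t, x)) has_derivative (\<lambda>v. (0, v))) (at x)"
      by (auto intro!: derivative_eq_intros)
    show "(?f has_derivative ?D) (at (t, x) within range (\<lambda>x. (t, x)))"
      using assms(2) by (intro has_derivative_subset[OF D]) auto
  qed
  then have "((\<lambda>x. ?f (t, x)) has_real_derivative ?D (0, 1)) (at x)"
  proof (rule has_derivative_imp_has_field_derivative)
    show "v * ?D (0, 1) = ?D (0, v)" for v
      using linear_cmul[OF has_derivative_linear[OF D], of v "(0, 1)"] by simp
  qed
  then show ?thesis by simp
qed

lemma dx_eqI: "(u t has_real_derivative d) (at x) \<Longrightarrow> \<partial>\<^sub>x u t x = d"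
  unfolding dx_def by (rule DERIV_imp_deriv)

lemma dt_eqI:
  assumes "t \<in> {0..1}" "((\<lambda>s. u s x) has_real_derivative d) (at t within {0..1})"
  shows "\<partial>\<^sub>t u t x = d"
  unfolding dt_def using assms vector_derivative_within_cbox[of 0 1 t "\<lambda>s. u s x" d]
  by (simp add: has_real_derivative_iff_has_vector_derivative)

lemma has_dx:
  assumes "smooth_field u" "t \<in> {0..1}"
  shows "(u t has_real_derivative \<partial>\<^sub>x u t x) (at x)"
  using smooth_field_dx_aux[OF assms] dx_eqI by metis

lemma has_dt_aux:
  assumes "smooth_field u" "t \<in> {0..1}"
  shows "((\<lambda>s. u s x) has_real_derivative
    frechet_derivative (\<lambda>z. u (fst z) (snd z)) (at (t, x) within {0..1} \<times> UNIV) (1, 0)) (at t within {0..1})"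
  using smooth_on_slice[OF smooth_field_smooth_on[OF assms(1)] assms(2), of x] by simp

lemma has_dt:
  assumes "smooth_field u" "t \<in> {0..1}"
  shows "((\<lambda>s. u s x) has_real_derivative \<partial>\<^sub>t u t x) (at t within {0..1})"
  using has_dt_aux[OF assms] dt_eqI[of t u x, OF assms(2)] by metis

lemma smooth_field_dx [field_intros]:
  assumes "smooth_field u"
  shows "smooth_field (\<partial>\<^sub>x u)"
  unfolding smooth_family_iff
proof (intro conjI ballI allI)
  show "smooth_on ({0..1} \<times> UNIV) (\<lambda>z. \<partial>\<^sub>x u (fst z) (snd z))"
    by (rule smooth_on_cong[OF _ smooth_on_frechet_derivative[OF smooth_field_smooth_on[OF assms], of "(0, 1)"]])
      (use dx_eqI[where u = u, OF smooth_field_dx_aux[OF assms]] in auto)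
  fix t x :: real assume t: "t \<in> {0..1}"
  have "(u t has_real_derivative \<partial>\<^sub>x u t (x + 1)) (at (x + 1))"
    using assms t by (rule has_dx)
  then have "((\<lambda>y. u t (y + 1)) has_real_derivative \<partial>\<^sub>x u t (x + 1)) (at x)"
    by (simp add: DERIV_shift)
  then have "(u t has_real_derivative \<partial>\<^sub>x u t (x + 1)) (at x)"
    using smooth_field_periodic[OF assms t] by simp
  then show "\<partial>\<^sub>x u t (x + 1) = \<partial>\<^sub>x u t x"
    using dx_eqI by metis
qed

lemma smooth_field_dt [field_intros]:
  assumes "smooth_field u"
  shows "smooth_field (\<partial>\<^sub>t u)"
  unfolding smooth_family_iff
proof (intro conjI ballI allI)
  show "smooth_on ({0..1} \<times> UNIV) (\<lambda>z. \<partial>\<^sub>t u (fst z) (snd z))"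
    by (rule smooth_on_cong[OF _ smooth_on_frechet_derivative[OF smooth_field_smooth_on[OF assms], of "(1, 0)"]])
      (use dt_eqI[where u = u, OF _ has_dt_aux[OF assms]] in auto)
  fix t x :: real assume t: "t \<in> {0..1}"
  have "((\<lambda>s. u s (x + 1)) has_real_derivative \<partial>\<^sub>t u t (x + 1)) (at t within {0..1})"
    by (rule has_dt[OF assms t])
  \<comment> \<open>Periodicity is known only for times in the unit interval, so the two time
    functions are identified within it.\<close>
  then have "((\<lambda>s. u s x) has_real_derivative \<partial>\<^sub>t u t (x + 1)) (at t within {0..1})"
    by (rule has_field_derivative_transform_within[where d = 1])
      (use t in \<open>auto simp: smooth_field_periodic[OF assms]\<close>)
  then show "\<partial>\<^sub>t u t (x + 1) = \<partial>\<^sub>t u t x"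
    using dt_eqI[of t u x, OF t] by metis
qed

lemma dx_add: "smooth_field u \<Longrightarrow> smooth_field v \<Longrightarrow> t \<in> {0..1} \<Longrightarrow>
    \<partial>\<^sub>x (\<lambda>t x. u t x + v t x) t x = \<partial>\<^sub>x u t x + \<partial>\<^sub>x v t x"
  by (intro dx_eqI DERIV_add has_dx)

lemma dx_diff: "smooth_field u \<Longrightarrow> smooth_field v \<Longrightarrow> t \<in> {0..1} \<Longrightarrow>
    \<partial>\<^sub>x (\<lambda>t x. u t x - v t x) t x = \<partial>\<^sub>x u t x - \<partial>\<^sub>x v t x"
  by (intro dx_eqI DERIV_diff has_dx)

lemma dx_mult: "smooth_field u \<Longrightarrow> smooth_field v \<Longrightarrow> t \<in> {0..1} \<Longrightarrow>
    \<partial>\<^sub>x (\<lambda>t x. u t x * v t x) t x = \<partial>\<^sub>x u t x * v t x + u t x * \<partial>\<^sub>x v t x"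
  by (intro dx_eqI) (auto intro!: derivative_eq_intros has_dx)

lemma dx_cmult: "smooth_field u \<Longrightarrow> t \<in> {0..1} \<Longrightarrow> \<partial>\<^sub>x (\<lambda>t x. c * u t x) t x = c * \<partial>\<^sub>x u t x"
  by (intro dx_eqI DERIV_cmult has_dx)

lemma dx_divide: "smooth_field u \<Longrightarrow> smooth_field v \<Longrightarrow> t \<in> {0..1} \<Longrightarrow> 0 < v t x \<Longrightarrow>
    \<partial>\<^sub>x (\<lambda>t x. u t x / v t x) t x = (\<partial>\<^sub>x u t x * v t x - u t x * \<partial>\<^sub>x v t x) / (v t x)\<^sup>2"
  by (intro dx_eqI) (auto intro!: derivative_eq_intros has_dx simp: power2_eq_square)

lemma dt_add: "smooth_field u \<Longrightarrow> smooth_field v \<Longrightarrow> t \<in> {0..1} \<Longrightarrow>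
    \<partial>\<^sub>t (\<lambda>t x. u t x + v t x) t x = \<partial>\<^sub>t u t x + \<partial>\<^sub>t v t x"
  by (rule dt_eqI, assumption, rule DERIV_add; rule has_dt)

lemma dt_mult: "smooth_field u \<Longrightarrow> smooth_field v \<Longrightarrow> t \<in> {0..1} \<Longrightarrow>
    \<partial>\<^sub>t (\<lambda>t x. u t x * v t x) t x = \<partial>\<^sub>t u t x * v t x + u t x * \<partial>\<^sub>t v t x"
  by (rule dt_eqI, assumption) (auto intro!: derivative_eq_intros has_dt)

lemma dt_cmult: "smooth_field u \<Longrightarrow> t \<in> {0..1} \<Longrightarrow> \<partial>\<^sub>t (\<lambda>t x. c * u t x) t x = c * \<partial>\<^sub>t u t x"
  by (rule dt_eqI, assumption, rule DERIV_cmult, rule has_dt)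

section \<open>Time slices, separated fields and integrals over the torus\<close>

lemma torus_smooth_slice:
  assumes "smooth_field u" "t \<in> {0..1}"
  shows "torus_smooth (u t)"
proof -
  have "bounded_linear (\<lambda>x::real. (0::real, x))"
    by (intro bounded_linear_Pair bounded_linear_zero bounded_linear_ident)
  then have "smooth_on UNIV (\<lambda>x. (\<lambda>z. u (fst z) (snd z)) ((t, 0) + (0, x)))"
    using assms(2) by (intro smooth_on_linear_reparam[OF _ smooth_field_smooth_on[OF assms(1)]]) auto
  then show ?thesis
    using smooth_field_periodic[OF assms] by (simp add: torus_smooth_def)
qed

lemma torus_smooth_diff: "torus_smooth f \<Longrightarrow> torus_smooth g \<Longrightarrow> torus_smooth (\<lambda>x. f x - g x)"
  by (simp add: torus_smooth_def smooth_on_diff)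

lemma torus_smooth_continuous: "torus_smooth f \<Longrightarrow> continuous_on S f"
  unfolding torus_smooth_def using smooth_on_continuous continuous_on_subset by blast

lemma smooth_field_space:
  assumes "torus_smooth \<eta>"
  shows "smooth_field (\<lambda>t. \<eta>)"
  using assms smooth_on_reparam[of "{0..1::real} \<times> UNIV" UNIV \<eta> snd]
  by (auto simp: smooth_family_iff torus_smooth_def bounded_linear_snd)

lemma smooth_field_polynomial:
  assumes "real_polynomial_function p"
  shows "smooth_field (\<lambda>t x. p t)"
  using assms
proof induction
  case (linear f)
  then have "smooth_on UNIV f" by (intro smooth_on_bounded_linear) auto
  then show ?case
    using smooth_on_reparam[of "{0..1::real} \<times> UNIV" UNIV f fst]
    by (auto simp: smooth_family_iff bounded_linear_fst)
qed (auto intro: field_intros)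

lemma smooth_field_continuous:
  assumes "smooth_field u" "T \<subseteq> {0..1}"
  shows "continuous_on (T \<times> X) (\<lambda>(t, x). u t x)"
  using smooth_on_continuous[OF smooth_field_smooth_on[OF assms(1)]] assms(2)
  by (auto simp: case_prod_unfold elim!: continuous_on_subset)

lemma smooth_field_integrable:
  assumes "smooth_field u" "t \<in> {0..1}"
  shows "u t integrable_on {0..1}"
  using torus_smooth_continuous[OF torus_smooth_slice[OF assms]] by (rule integrable_continuous_real)

lemma smooth_field_integral_continuous:
  assumes "smooth_field u"
  shows "continuous_on {0..1} (\<lambda>t. integral {0..1} (\<lambda>x. u t x))"
  using integral_continuous_on_param[of "{0..1}" 0 1 u] smooth_field_continuous[OF assms, of "{0..1}" "{0..1}"]
  by simp

lemma smooth_field_integral_box: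
  assumes "smooth_field u"
  shows "integral (cbox (0, 0) (1, 1)) (\<lambda>z. u (fst z) (snd z)) = integral {0..1} (\<lambda>t. integral {0..1} (\<lambda>x. u t x))"
  using integral_prod_continuous[of 0 0 1 1 "\<lambda>z. u (fst z) (snd z)"]
    smooth_field_continuous[OF assms, of "{0..1}" "{0..1}"]
  by (simp add: cbox_Pair_eq case_prod_unfold)

text \<open>Periodicity cancels the boundary terms; every integration by parts in x below is an
  instance.\<close>

lemma integral_dx_eq_0:
  assumes "smooth_field u" "t \<in> {0..1}"
  shows "integral {0..1} (\<lambda>x. \<partial>\<^sub>x u t x) = 0"
proof -
  have "((\<lambda>x. \<partial>\<^sub>x u t x) has_integral u t 1 - u t 0) {0..1}"
    by (rule fundamental_theorem_of_calculus)
      (auto simp: has_real_derivative_iff_has_vector_derivative[symmetric] intro!: DERIV_subset[OF has_dx[OF assms]])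
  then show ?thesis
    using smooth_field_periodic[OF assms, of 0] by (simp add: integral_unique)
qed

text \<open>Fubini followed by the fundamental theorem in time. The boundary values that remain are
  the origin of the terminal conditions.\<close>

lemma integral_dt:
  assumes "smooth_field u"
  shows "integral {0..1} (\<lambda>t. integral {0..1} (\<lambda>x. \<partial>\<^sub>t u t x)) = integral {0..1} (\<lambda>x. u 1 x - u 0 x)"
proof -
  have "integral {0..1} (\<lambda>t. integral {0..1} (\<lambda>x. \<partial>\<^sub>t u t x)) = integral {0..1} (\<lambda>x. integral {0..1} (\<lambda>t. \<partial>\<^sub>t u t x))"
    using integral_swap_continuous[of 0 0 1 1 "\<partial>\<^sub>t u"]
      smooth_field_continuous[OF smooth_field_dt[OF assms], of "{0..1}" "{0..1}"]
    by (simp add: cbox_Pair_eq)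
  also have "\<dots> = integral {0..1} (\<lambda>x. u 1 x - u 0 x)"
  proof (intro integral_cong integral_unique fundamental_theorem_of_calculus)
    show "((\<lambda>t. u t x) has_vector_derivative \<partial>\<^sub>t u t x) (at t within {0..1})" if "t \<in> {0..1}" for t x
      using has_dt[OF assms that] by (simp add: has_real_derivative_iff_has_vector_derivative)
  qed simp
  finally show ?thesis .
qed

section \<open>First variations and the fundamental lemma\<close>

lemma torus_periodic_int:
  assumes "torus_smooth g"
  shows "g (x + of_int n) = g x"
proof (induction n rule: int_induct[where k = 0])
  case (step1 i)
  then show ?case using assms by (simp add: torus_smooth_def flip: add.assoc)
next
  case (step2 i)
  have "g (x + of_int (i - 1) + 1) = g (x + of_int (i - 1))"
    using assms unfolding torus_smooth_def by blast
  moreover have "x + of_int (i - 1) + 1 = x + of_int i" by simp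
  ultimately show ?case using step2 by metis
qed simp

text \<open>Continuity settles one period; the fractional part carries the conclusion to the whole
  line.\<close>

lemma torus_smooth_null:
  assumes "torus_smooth g" "integral {0..1} (\<lambda>x. g x * g x) = 0"
  shows "g x = 0"
proof -
  have "continuous_on {0..1} (\<lambda>x. g x * g x)"
    by (intro continuous_on_mult torus_smooth_continuous assms(1))
  then have "\<forall>y\<in>{0..1}. g y * g y = 0"
    using integral_eq_0_iff[of 0 1 "\<lambda>x. g x * g x"] assms(2) by simp
  then have "g (frac x) = 0"
    using frac_ge_0[of x] frac_lt_1[of x] by (simp add: less_imp_le)
  then show ?thesis
    using torus_periodic_int[OF assms(1), of "frac x" "\<lfloor>x\<rfloor>"] by (simp add: frac_def)
qed

lemma integral_torus_mult_diff:
  assumes "torus_smooth f" "torus_smooth g" "torus_smooth k"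
  shows "integral {0..1} (\<lambda>x. (f x - g x) * k x) = integral {0..1} (\<lambda>x. f x * k x) - integral {0..1} (\<lambda>x. g x * k x)"
  unfolding left_diff_distrib
  by (intro integral_diff integrable_continuous_real continuous_on_mult torus_smooth_continuous assms)

lemma integral_torus_mult_add:
  assumes "torus_smooth f" "torus_smooth g" "torus_smooth k"
  shows "integral {0..1} (\<lambda>x. (f x + g x) * k x) = integral {0..1} (\<lambda>x. f x * k x) + integral {0..1} (\<lambda>x. g x * k x)"
  unfolding distrib_right
  by (intro integral_add integrable_continuous_real continuous_on_mult torus_smooth_continuous assms)

lemma torus_smooth_add: "torus_smooth f \<Longrightarrow> torus_smooth g \<Longrightarrow> torus_smooth (\<lambda>x. f x + g x)"
  by (simp add: torus_smooth_def smooth_on_add)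

text \<open>The difference of two smooth periodic functions is itself an admissible test
  function.\<close>

lemma torus_eqI:
  assumes "torus_smooth f" "torus_smooth g"
    and "\<And>h. torus_smooth h \<Longrightarrow> integral {0..1} (\<lambda>x. f x * h x) = integral {0..1} (\<lambda>x. g x * h x)"
  shows "f = g"
proof
  fix x
  let ?d = "\<lambda>x. f x - g x"
  have d: "torus_smooth ?d" using assms(1,2) by (rule torus_smooth_diff)
  have "integral {0..1} (\<lambda>x. ?d x * ?d x) = integral {0..1} (\<lambda>x. f x * ?d x - g x * ?d x)"
    by (simp add: algebra_simps)
  also have "\<dots> = integral {0..1} (\<lambda>x. f x * ?d x) - integral {0..1} (\<lambda>x. g x * ?d x)"
    using assms(1,2) d by (intro integral_diff integrable_continuous_real continuous_intros torus_smooth_continuous)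
  also have "\<dots> = 0" using assms(3)[OF d] by simp
  finally have "?d x = 0" by (rule torus_smooth_null[OF d])
  then show "f x = g x" by simp
qed

text \<open>Justifies the definite description: two variations have the same pairings by uniqueness
  of derivatives, hence coincide by \<open>torus_eqI\<close>.\<close>

lemma has_L2_variation_L2_variation:
  assumes "has_L2_variation J u g"
  shows "has_L2_variation J u (L2_variation J u)"
proof -
  have "g' = g" if "has_L2_variation J u g'" for g'
    using that assms unfolding has_L2_variation_def
    by (intro torus_eqI) (auto intro: DERIV_unique)
  then show ?thesis
    unfolding L2_variation_def using assms by (metis theI)
qed

(* Approximating w by polynomials p, the weighted integral of w^2 is at most that of (w - p)^2,
   because the mixed term vanishes by hypothesis. *)
lemma time_null:
  assumes w: "continuous_on {0..1} w"
    and null: "\<And>p. real_polynomial_function p \<Longrightarrow> integral {0..1} (\<lambda>t. t * (1 - t) * p t * w t) = 0"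
    and t: "t \<in> {0..1}"
  shows "w t = (0::real)"
proof -
  let ?c = "\<lambda>t::real. t * (1 - t)"
  have c: "0 \<le> ?c s" "?c s \<le> 1" if "s \<in> {0..1}" for s :: real
    using that mult_le_one[of s "1 - s"] by auto
  have "integral {0..1} (\<lambda>t. ?c t * (w t)\<^sup>2) \<le> 0 + e" if e: "e > 0" for e
  proof -
    \<comment> \<open>The tolerance is \<open>sqrt e\<close> because the error enters squared; as
      the weight is at most 1, the integral stays below \<open>e\<close>.\<close>
    obtain p where p: "real_polynomial_function p" and wp: "\<And>s. s \<in> {0..1} \<Longrightarrow> \<bar>w s - p s\<bar> < sqrt e"
      using Stone_Weierstrass_real_polynomial_function[of "{0..1}" w "sqrt e"] w e by auto
    have pc: "continuous_on {0..1} p"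
      using p by (intro continuous_on_polymonial_function) (simp add: real_polynomial_function_eq)
    have "integral {0..1} (\<lambda>t. ?c t * (w t)\<^sup>2)
        \<le> integral {0..1} (\<lambda>t. ?c t * (w t)\<^sup>2) + integral {0..1} (\<lambda>t. ?c t * (p t)\<^sup>2)"
      using c by (auto intro!: integral_nonneg integrable_continuous_real continuous_intros pc)
    also have "\<dots> = integral {0..1} (\<lambda>t. ?c t * (w t)\<^sup>2) + integral {0..1} (\<lambda>t. ?c t * (p t)\<^sup>2)
        - 2 * integral {0..1} (\<lambda>t. t * (1 - t) * p t * w t)"
      using null[OF p] by simp
    also have "\<dots> = integral {0..1} (\<lambda>t. ?c t * (w t)\<^sup>2 + ?c t * (p t)\<^sup>2 - 2 * (t * (1 - t) * p t * w t))"
      by (simp add: integral_diff integral_add integrable_continuous_real continuous_intros pc w)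
    also have "\<dots> = integral {0..1} (\<lambda>t. ?c t * (w t - p t)\<^sup>2)"
      by (simp add: algebra_simps power2_eq_square)
    also have "\<dots> \<le> integral {0..1} (\<lambda>t::real. e)"
    proof (rule integral_le)
      fix s :: real assume s: "s \<in> {0..1}"
      have "(w s - p s)\<^sup>2 \<le> (sqrt e)\<^sup>2"
        using wp[OF s] by (metis less_imp_le abs_le_square_iff abs_ge_zero abs_of_nonneg order_trans)
      then have "?c s * (w s - p s)\<^sup>2 \<le> 1 * e"
        using c[OF s] e by (intro mult_mono) auto
      then show "?c s * (w s - p s)\<^sup>2 \<le> e" by simp
    qed (auto intro!: integrable_continuous_real continuous_intros pc w)
    finally show ?thesis by simp
  qed
  then have "integral {0..1} (\<lambda>t. ?c t * (w t)\<^sup>2) \<le> 0"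
    by (rule field_le_epsilon)
  moreover have "integral {0..1} (\<lambda>t. ?c t * (w t)\<^sup>2) \<ge> 0"
    using c by (auto intro!: integral_nonneg integrable_continuous_real continuous_intros w)
  moreover have "continuous_on {0..1} (\<lambda>t. ?c t * (w t)\<^sup>2)"
    by (intro continuous_intros w)
  ultimately have *: "\<forall>s\<in>{0..1}. ?c s * (w s)\<^sup>2 = 0"
    using integral_eq_0_iff[of 0 1 "\<lambda>t. ?c t * (w t)\<^sup>2"] c by simp
  \<comment> \<open>The weight vanishes at both ends, so only interior times are reached directly;
    continuity supplies the end points.\<close>
  have "w s = 0" if "s \<in> {0<..<1}" for s
    using bspec[OF *, of s] that by auto
  then show ?thesis
    using continuous_constant_on_closure[of "{0<..<1::real}" w 0 t] w t by simp
qed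

text \<open>Test fields vanishing at both end times are admissible for states with fixed initial
  value and for free fields alike. The factor \<open>s * (1 - s)\<close> enforces this and is the
  weight of \<open>time_null\<close>. With the profile frozen at \<open>E t\<close>, the resulting
  function of \<open>s\<close> takes at \<open>s = t\<close> the squared norm of \<open>E t\<close>
  as its value.\<close>

lemma field_null:
  assumes E: "\<And>t. t \<in> {0..1} \<Longrightarrow> torus_smooth (E t)"
    and cont: "\<And>\<eta>. torus_smooth \<eta> \<Longrightarrow> continuous_on {0..1} (\<lambda>t. integral {0..1} (\<lambda>x. E t x * \<eta> x))"
    and null: "\<And>h. smooth_field h \<Longrightarrow> (\<And>x. h 0 x = 0) \<Longrightarrow> (\<And>x. h 1 x = 0) \<Longrightarrow>
      integral {0..1} (\<lambda>t. integral {0..1} (\<lambda>x. E t x * h t x)) = 0"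
    and t: "t \<in> {0..1}"
  shows "E t x = 0"
proof (rule torus_smooth_null[OF E[OF t]])
  show "integral {0..1} (\<lambda>x. E t x * E t x) = 0"
  proof (rule time_null[OF cont[OF E[OF t]] _ t])
    fix p :: "real \<Rightarrow> real" assume p: "real_polynomial_function p"
    have "real_polynomial_function (\<lambda>s::real. s)"
      by (rule real_polynomial_function.intros(1)[OF bounded_linear_ident])
    then have "real_polynomial_function (\<lambda>s. s * (1 - s) * p s)"
      using p by (intro real_polynomial_function.intros(2,4) real_polynomial_function_diff)
    then have "smooth_field (\<lambda>s x. s * (1 - s) * p s * E t x)"
      using smooth_field_mult[OF smooth_field_polynomial smooth_field_space[OF E[OF t]]] by blast
    then have "integral {0..1} (\<lambda>s. integral {0..1} (\<lambda>x. E s x * (s * (1 - s) * p s * E t x))) = 0"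
      by (rule null) auto
    moreover have "integral {0..1} (\<lambda>x. E s x * (s * (1 - s) * p s * E t x))
        = s * (1 - s) * p s * integral {0..1} (\<lambda>x. E s x * E t x)" for s
      by (subst integral_mult_right[symmetric]) (simp add: mult_ac)
    ultimately show "integral {0..1} (\<lambda>s. s * (1 - s) * p s * integral {0..1} (\<lambda>x. E s x * E t x)) = 0"
      by simp
  qed
qed

section \<open>Perturbed fields\<close>

text \<open>Compactness gives the bound on one period, periodicity on the whole line.\<close>

lemma smooth_field_bounded:
  assumes "smooth_field u"
  obtains M where "0 < M" "\<And>t x. t \<in> {0..1} \<Longrightarrow> \<bar>u t x\<bar> \<le> M"
proof -
  have "compact ((\<lambda>(t, x). u t x) ` ({0..1} \<times> {0..1}))"
    using smooth_field_continuous[OF assms, of "{0..1}" "{0..1}"]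
    by (intro compact_continuous_image compact_Times) auto
  then obtain M where "0 < M" and M: "\<And>y. y \<in> (\<lambda>(t, x). u t x) ` ({0..1} \<times> {0..1}) \<Longrightarrow> \<bar>y\<bar> \<le> M"
    using bounded_pos[THEN iffD1, OF compact_imp_bounded] by (metis real_norm_def)
  show ?thesis
  proof (rule that[OF \<open>0 < M\<close>])
    fix t x :: real assume t: "t \<in> {0..1}"
    have "u t (frac x) \<in> (\<lambda>(t, x). u t x) ` ({0..1} \<times> {0..1})"
      using t frac_ge_0[of x] frac_lt_1[of x] by (intro image_eqI[of _ _ "(t, frac x)"]) (auto simp: less_imp_le)
    moreover have "u t x = u t (frac x)"
      using torus_periodic_int[OF torus_smooth_slice[OF assms t], of "frac x" "\<lfloor>x\<rfloor>"] by (simp add: frac_def)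
    ultimately show "\<bar>u t x\<bar> \<le> M"
      using M by simp
  qed
qed

text \<open>The ratio \<open>h / r\<close> is a smooth field, hence bounded; bounding it handles the
  size of \<open>h\<close> and the lower bound on \<open>r\<close> together.\<close>

lemma perturbation_positive:
  assumes r: "smooth_field r" "\<And>t x. t \<in> {0..1} \<Longrightarrow> 0 < r t x" and h: "smooth_field h"
  obtains e where "0 < e" "\<And>\<epsilon> t x. \<epsilon> \<in> {-e..e} \<Longrightarrow> t \<in> {0..1} \<Longrightarrow> 0 < r t x + \<epsilon> * h t x"
proof -
  obtain M where "0 < M" and M: "\<And>t x. t \<in> {0..1} \<Longrightarrow> \<bar>h t x / r t x\<bar> \<le> M"
    using smooth_field_bounded[OF smooth_field_divide[OF h r]] by blast
  show ?thesis
  \<comment> \<open>With this radius the relative change is at most 1/2 in modulus, so at least half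
    of \<open>r\<close> remains.\<close>
  proof (rule that[of "1 / (2 * M)"])
    fix \<epsilon> t x :: real assume \<epsilon>: "\<epsilon> \<in> {-(1 / (2 * M))..1 / (2 * M)}" and t: "t \<in> {0..1}"
    have "\<bar>\<epsilon> * (h t x / r t x)\<bar> \<le> 1 / (2 * M) * M"
      unfolding abs_mult using \<epsilon> M[OF t] \<open>0 < M\<close> by (intro mult_mono) auto
    also have "1 / (2 * M) * M = 1 / 2"
      using \<open>0 < M\<close> by simp
    finally have "\<epsilon> * (h t x / r t x) \<ge> - (1 / 2)"
      by linarith
    then have "0 < r t x * (1 + \<epsilon> * (h t x / r t x))"
      using r(2)[OF t] by (intro mult_pos_pos) auto
    also have "\<dots> = r t x + \<epsilon> * h t x"
      using r(2)[OF t, of x] by (simp add: field_simps)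
    finally show "0 < r t x + \<epsilon> * h t x" .
  qed (use \<open>0 < M\<close> in simp)
qed

lemma smooth_field_perturb [field_intros]:
  "smooth_field u \<Longrightarrow> smooth_field h \<Longrightarrow> smooth_field (\<lambda>t x. u t x + \<epsilon> * h t x)"
  by (intro field_intros)

lemma smooth_on_snd_field:
  fixes e :: real
  assumes "smooth_field u" "e > 0"
  shows "smooth_on ({-e..e} \<times> ({0..1} \<times> UNIV)) (\<lambda>w. u (fst (snd w)) (snd (snd w)))"
proof (rule smooth_on_reparam[OF _ smooth_field_smooth_on[OF assms(1)] bounded_linear_snd])
  show "fat ({-e..e} \<times> ({0..1::real} \<times> (UNIV :: real set)))"
    using assms(2) by simp
qed auto

lemma smooth_on_perturb:
  assumes "smooth_field u" "smooth_field h" "e > 0"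
  shows "smooth_on ({-e..e} \<times> ({0..1} \<times> UNIV)) (\<lambda>w. u (fst (snd w)) (snd (snd w)) + fst w * h (fst (snd w)) (snd (snd w)))"
  using assms by (intro smooth_on_add smooth_on_mult smooth_on_snd_field smooth_on_bounded_linear bounded_linear_fst) auto

text \<open>For a functional, \<epsilon> and t are parameters and x is the variable of its argument,
  whereas fields group t with x; the proof regroups the coordinates.\<close>

lemma smooth_family_perturb:
  assumes "smooth_field u" "smooth_field h" "e > 0"
  shows "smooth_family ({-e..e} \<times> {0..1}) (\<lambda>p x. u (snd p) x + fst p * h (snd p) x)"
proof -
  have "bounded_linear (\<lambda>z :: (real \<times> real) \<times> real. (fst (fst z), snd (fst z), snd z))"
    by (intro bounded_linear_Pair bounded_linear_compose[OF bounded_linear_fst] bounded_linear_compose[OF bounded_linear_snd]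
        bounded_linear_fst bounded_linear_snd)
  from smooth_on_reparam[OF _ smooth_on_perturb[OF assms] this, of "({-e..e} \<times> {0..1}) \<times> UNIV"] assms(3)
  have "smooth_on (({-e..e} \<times> {0..1}) \<times> UNIV) (\<lambda>z. u (snd (fst z)) (snd z) + fst (fst z) * h (snd (fst z)) (snd z))"
    by auto
  then show ?thesis
    using smooth_field_periodic[OF assms(1)] smooth_field_periodic[OF assms(2)]
    by (simp add: smooth_family_iff)
qed

text \<open>The two parameters in \<open>smooth_functional\<close> are used here as \<epsilon> and
  time.\<close>

lemma smooth_functional_perturb:
  assumes "smooth_functional F" "smooth_field r" "smooth_field m" "smooth_field h" "smooth_field n" "e > 0"
    and pos: "\<And>\<epsilon> t x. \<epsilon> \<in> {-e..e} \<Longrightarrow> t \<in> {0..1} \<Longrightarrow> 0 < r t x + \<epsilon> * h t x"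
  shows "smooth_on ({-e..e} \<times> {0..1})
    (\<lambda>p. F (\<lambda>x. r (snd p) x + fst p * h (snd p) x) (\<lambda>x. m (snd p) x + fst p * n (snd p) x))"
proof -
  have "- e < e \<and> (0::real) < 1 \<and> smooth_family ({-e..e} \<times> {0..1}) (\<lambda>p x. r (snd p) x + fst p * h (snd p) x) \<and>
    smooth_family ({-e..e} \<times> {0..1}) (\<lambda>p x. m (snd p) x + fst p * n (snd p) x) \<and>
    (\<forall>p\<in>{-e..e} \<times> {0..1}. \<forall>x. 0 < r (snd p) x + fst p * h (snd p) x)"
    using assms by (auto intro: smooth_family_perturb)
  then show ?thesis
    using assms(1) unfolding smooth_functional_def by blast
qed

lemma smooth_functional_continuous:
  assumes "smooth_functional F" "smooth_field r" "smooth_field m" "\<And>t x. t \<in> {0..1} \<Longrightarrow> 0 < r t x"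
  shows "continuous_on {0..1} (\<lambda>t. F (r t) (m t))"
proof -
  \<comment> \<open>Zero perturbations make \<epsilon> a dummy parameter, which is then set to
    0.\<close>
  have "continuous_on ({-1..1} \<times> {0..1}) (\<lambda>p. F (\<lambda>x. r (snd p) x + fst p * 0) (\<lambda>x. m (snd p) x + fst p * 0))"
    using assms by (intro smooth_on_continuous smooth_functional_perturb field_intros) auto
  moreover have "continuous_on {0..1} (\<lambda>t. (0::real, t::real))"
    by (intro continuous_intros)
  ultimately have "continuous_on {0..1} ((\<lambda>p. F (\<lambda>x. r (snd p) x + fst p * 0) (\<lambda>x. m (snd p) x + fst p * 0)) \<circ> Pair 0)"
    by (intro continuous_on_compose) (auto elim: continuous_on_subset)
  then show ?thesis by (simp add: o_def)
qed

lemma has_var_rho: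
  assumes "smooth_functional F" "torus_smooth r" "torus_smooth m" "\<And>x. 0 < r x"
  shows "has_L2_variation (\<lambda>r'. F r' m) r (var_rho F r m)"
  using assms has_L2_variation_L2_variation unfolding smooth_functional_def var_rho_def by blast

lemma has_var_m:
  assumes "smooth_functional F" "torus_smooth r" "torus_smooth m" "\<And>x. 0 < r x"
  shows "has_L2_variation (\<lambda>m'. F r m') m (var_m F r m)"
  using assms has_L2_variation_L2_variation unfolding smooth_functional_def var_m_def by blast

text \<open>At each fixed time the \<epsilon>-derivative is a pairing by definition of the
  variation; joint smoothness in \<epsilon> and t moves it under the time integral. The second claim
  is the weak continuity in time of \<open>var_rho\<close> along the fields.\<close>

lemma has_derivative_functional_rho:
  assumes F: "smooth_functional F" and r: "smooth_field r" "\<And>t x. t \<in> {0..1} \<Longrightarrow> 0 < r t x"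
    and m: "smooth_field m" and h: "smooth_field h"
  shows "((\<lambda>\<epsilon>. integral {0..1} (\<lambda>t. F (\<lambda>x. r t x + \<epsilon> * h t x) (m t))) has_real_derivative
      integral {0..1} (\<lambda>t. integral {0..1} (\<lambda>x. var_rho F (r t) (m t) x * h t x))) (at 0)"
    and "continuous_on {0..1} (\<lambda>t. integral {0..1} (\<lambda>x. var_rho F (r t) (m t) x * h t x))"
proof -
  obtain e where e: "0 < e" "\<And>\<epsilon> t x. \<epsilon> \<in> {-e..e} \<Longrightarrow> t \<in> {0..1} \<Longrightarrow> 0 < r t x + \<epsilon> * h t x"
    using perturbation_positive[OF r h] by blast
  have K: "smooth_on ({-e..e} \<times> cbox 0 1) (\<lambda>p. F (\<lambda>x. r (snd p) x + fst p * h (snd p) x) (m (snd p)))"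
    using smooth_functional_perturb[OF F r(1) m h smooth_field_const[of 0] e] by simp
  have D: "((\<lambda>\<epsilon>. F (\<lambda>x. r t x + \<epsilon> * h t x) (m t)) has_real_derivative
      integral {0..1} (\<lambda>x. var_rho F (r t) (m t) x * h t x)) (at 0)" if "t \<in> cbox 0 1" for t
  proof -
    have t: "t \<in> {0..1}" using that by simp
    show ?thesis
      using has_var_rho[OF F torus_smooth_slice[OF r(1) t] torus_smooth_slice[OF m t] r(2)[OF t]] torus_smooth_slice[OF h t]
      unfolding has_L2_variation_def by blast
  qed
  show "((\<lambda>\<epsilon>. integral {0..1} (\<lambda>t. F (\<lambda>x. r t x + \<epsilon> * h t x) (m t))) has_real_derivative
      integral {0..1} (\<lambda>t. integral {0..1} (\<lambda>x. var_rho F (r t) (m t) x * h t x))) (at 0)"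
    using has_derivative_integral_smooth(1)[OF e(1) _ K D] by simp
  show "continuous_on {0..1} (\<lambda>t. integral {0..1} (\<lambda>x. var_rho F (r t) (m t) x * h t x))"
    using has_derivative_integral_smooth(2)[OF e(1) _ K D] by simp
qed

lemma has_derivative_functional_m:
  assumes F: "smooth_functional F" and r: "smooth_field r" "\<And>t x. t \<in> {0..1} \<Longrightarrow> 0 < r t x"
    and m: "smooth_field m" and n: "smooth_field n"
  shows "((\<lambda>\<epsilon>. integral {0..1} (\<lambda>t. F (r t) (\<lambda>x. m t x + \<epsilon> * n t x))) has_real_derivative
      integral {0..1} (\<lambda>t. integral {0..1} (\<lambda>x. var_m F (r t) (m t) x * n t x))) (at 0)"
    and "continuous_on {0..1} (\<lambda>t. integral {0..1} (\<lambda>x. var_m F (r t) (m t) x * n t x))"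
proof -
  \<comment> \<open>The density is left alone, so every \<epsilon> is admissible and the radius 1 is
    arbitrary.\<close>
  have K: "smooth_on ({-1..1} \<times> cbox 0 1) (\<lambda>p. F (r (snd p)) (\<lambda>x. m (snd p) x + fst p * n (snd p) x))"
    using smooth_functional_perturb[OF F r(1) m smooth_field_const[of 0] n, of 1] r(2) by simp
  have D: "((\<lambda>\<epsilon>. F (r t) (\<lambda>x. m t x + \<epsilon> * n t x)) has_real_derivative
      integral {0..1} (\<lambda>x. var_m F (r t) (m t) x * n t x)) (at 0)" if "t \<in> cbox 0 1" for t
  proof -
    have t: "t \<in> {0..1}" using that by simp
    show ?thesis
      using has_var_m[OF F torus_smooth_slice[OF r(1) t] torus_smooth_slice[OF m t] r(2)[OF t]] torus_smooth_slice[OF n t]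
      unfolding has_L2_variation_def by blast
  qed
  show "((\<lambda>\<epsilon>. integral {0..1} (\<lambda>t. F (r t) (\<lambda>x. m t x + \<epsilon> * n t x))) has_real_derivative
      integral {0..1} (\<lambda>t. integral {0..1} (\<lambda>x. var_m F (r t) (m t) x * n t x))) (at 0)"
    using has_derivative_integral_smooth(1)[OF _ _ K D] by simp
  show "continuous_on {0..1} (\<lambda>t. integral {0..1} (\<lambda>x. var_m F (r t) (m t) x * n t x))"
    using has_derivative_integral_smooth(2)[OF _ _ K D] by simp
qed

section \<open>Vanishing variations\<close>

text \<open>Test fields vanishing at both ends determine \<open>E\<close>; once \<open>E\<close> is
  zero, the terminal pairing stands alone and determines \<open>B\<close>.\<close>

lemma has_state_variation_zero_iff:
  assumes D: "\<And>h. smooth_field h \<Longrightarrow> (\<And>x. h 0 x = 0) \<Longrightarrow>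
      ((\<lambda>\<epsilon>. J (\<lambda>t x. u t x + \<epsilon> * h t x)) has_real_derivative
         integral {0..1} (\<lambda>t. integral {0..1} (\<lambda>x. E t x * h t x)) + integral {0..1} (\<lambda>x. B x * h 1 x)) (at 0)"
    and E: "\<And>t. t \<in> {0..1} \<Longrightarrow> torus_smooth (E t)"
    and cont: "\<And>\<eta>. torus_smooth \<eta> \<Longrightarrow> continuous_on {0..1} (\<lambda>t. integral {0..1} (\<lambda>x. E t x * \<eta> x))"
    and B: "torus_smooth B"
  shows "has_state_variation J u (\<lambda>_ _. 0) (\<lambda>_. 0) \<longleftrightarrow> (\<forall>t\<in>{0..1}. \<forall>x. E t x = 0) \<and> (\<forall>x. B x = 0)"
proof
  assume "has_state_variation J u (\<lambda>_ _. 0) (\<lambda>_. 0)"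
  then have null: "integral {0..1} (\<lambda>t. integral {0..1} (\<lambda>x. E t x * h t x)) + integral {0..1} (\<lambda>x. B x * h 1 x) = 0"
    if "smooth_field h" "\<And>x. h 0 x = 0" for h
    using DERIV_unique[OF D[OF that]] that unfolding has_state_variation_def by simp
  have E0: "E t x = 0" if "t \<in> {0..1}" for t x
  proof (rule field_null[OF E cont _ that])
    fix h assume "smooth_field h" "\<And>x. h 0 x = 0" "\<And>x. h 1 x = 0"
    then show "integral {0..1} (\<lambda>t. integral {0..1} (\<lambda>x. E t x * h t x)) = 0"
      using null[of h] by simp
  qed
  \<comment> \<open>This perturbation vanishes at time 0, as required, and equals \<open>B\<close>
    at time 1, which leaves the squared norm of \<open>B\<close>.\<close>
  have "smooth_field (\<lambda>t x. t * B x)"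
    by (intro smooth_field_mult smooth_field_polynomial smooth_field_space[OF B] real_polynomial_function.intros(1) bounded_linear_ident)
  then have "integral {0..1} (\<lambda>t. integral {0..1} (\<lambda>x. E t x * (t * B x))) + integral {0..1} (\<lambda>x. B x * (1 * B x)) = 0"
    by (rule null) simp
  moreover have "integral {0..1} (\<lambda>t. integral {0..1} (\<lambda>x. E t x * (t * B x))) = integral {0..1} (\<lambda>t::real. 0)"
    by (intro integral_cong) (simp add: E0)
  ultimately have "integral {0..1} (\<lambda>x. B x * B x) = 0"
    by simp
  then show "(\<forall>t\<in>{0..1}. \<forall>x. E t x = 0) \<and> (\<forall>x. B x = 0)"
    using E0 torus_smooth_null[OF B] by blast
next
  assume 0: "(\<forall>t\<in>{0..1}. \<forall>x. E t x = 0) \<and> (\<forall>x. B x = 0)"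
  have "integral {0..1} (\<lambda>t. integral {0..1} (\<lambda>x. E t x * h t x)) = integral {0..1} (\<lambda>t::real. 0)" for h
    using 0 by (intro integral_cong) simp
  then show "has_state_variation J u (\<lambda>_ _. 0) (\<lambda>_. 0)"
    using D 0 unfolding has_state_variation_def by simp
qed

text \<open>Free fields admit all perturbations, in particular those of \<open>field_null\<close>;
  joint smoothness of \<open>E\<close> makes its pairings continuous in time.\<close>

lemma has_field_variation_zero_iff:
  assumes D: "\<And>h. smooth_field h \<Longrightarrow>
      ((\<lambda>\<epsilon>. J (\<lambda>t x. u t x + \<epsilon> * h t x)) has_real_derivative
         integral {0..1} (\<lambda>t. integral {0..1} (\<lambda>x. E t x * h t x))) (at 0)"
    and E: "smooth_field E"
  shows "has_field_variation J u (\<lambda>_ _. 0) \<longleftrightarrow> (\<forall>t\<in>{0..1}. \<forall>x. E t x = 0)"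
proof
  assume "has_field_variation J u (\<lambda>_ _. 0)"
  then have null: "integral {0..1} (\<lambda>t. integral {0..1} (\<lambda>x. E t x * h t x)) = 0" if "smooth_field h" for h
    using DERIV_unique[OF D[OF that]] that unfolding has_field_variation_def by simp
  have "E t x = 0" if "t \<in> {0..1}" for t x
    by (rule field_null[OF torus_smooth_slice[OF E] smooth_field_integral_continuous null that])
      (auto intro!: smooth_field_mult E smooth_field_space)
  then show "\<forall>t\<in>{0..1}. \<forall>x. E t x = 0" by blast
next
  assume 0: "\<forall>t\<in>{0..1}. \<forall>x. E t x = 0"
  have "integral {0..1} (\<lambda>t. integral {0..1} (\<lambda>x. E t x * h t x)) = integral {0..1} (\<lambda>t::real. 0)" for h
    using 0 by (intro integral_cong) simp
  then show "has_field_variation J u (\<lambda>_ _. 0)"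
    using D unfolding has_field_variation_def by simp
qed

section \<open>The weak form of the Lagrangian\<close>

(* The integrand of the Lagrangian after moving the x-derivative in the momentum equation onto psi;
   in this form it depends on first derivatives of the fields only, which enter as separate
   arguments rt, rx, mt, mx, \<psi>x. *)
definition dens where
  "dens \<beta> P \<mu> r rt rx m mt mx a \<phi> \<psi> \<psi>x =
     1/2 * a\<^sup>2 * \<mu> r + \<phi> * (rt + mx) + \<psi> * mt
     - \<psi>x * (m\<^sup>2 / r + P r + \<mu> r * a - \<beta> * (\<mu> r * ((mx * r - m * rx) / r\<^sup>2)))"
  for \<beta> r :: real

text \<open>The quotient \<open>(mx * r - m * rx) / r\<^sup>2\<close> stands for the x-derivative of
  the velocity \<open>m / r\<close>, which explains the nested quotient in its
  \<epsilon>-derivative.\<close>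

lemma dens_has_derivative:
  fixes r :: real
  assumes r: "0 < r" and P: "(P has_real_derivative P') (at r)" and \<mu>: "(\<mu> has_real_derivative \<mu>') (at r)"
  shows "((\<lambda>\<epsilon>. dens \<beta> P \<mu> (r + \<epsilon> * h) (rt + \<epsilon> * ht) (rx + \<epsilon> * hx) (m + \<epsilon> * n) (mt + \<epsilon> * nt) (mx + \<epsilon> * nx)
      (a + \<epsilon> * b) (\<phi> + \<epsilon> * p) (\<psi> + \<epsilon> * q) (\<psi>x + \<epsilon> * qx)) has_real_derivative
      a * b * \<mu> r + 1/2 * a\<^sup>2 * (\<mu>' * h) + (p * (rt + mx) + \<phi> * (ht + nx)) + (q * mt + \<psi> * nt)
      - (qx * (m\<^sup>2 / r + P r + \<mu> r * a - \<beta> * (\<mu> r * ((mx * r - m * rx) / r\<^sup>2)))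
        + \<psi>x * ((2 * m * n * r - m\<^sup>2 * h) / r\<^sup>2 + P' * h + (\<mu>' * h * a + \<mu> r * b)
          - \<beta> * (\<mu>' * h * ((mx * r - m * rx) / r\<^sup>2)
            + \<mu> r * (((nx * r + mx * h - n * rx - m * hx) * r\<^sup>2 - (mx * r - m * rx) * (2 * r * h)) / (r\<^sup>2 * r\<^sup>2)))))) (at 0)"
proof -
  have lin: "((\<lambda>\<epsilon>. r + \<epsilon> * h) has_real_derivative h) (at 0)"
    by (auto intro!: derivative_eq_intros)
  have Ph: "((\<lambda>\<epsilon>. P (r + \<epsilon> * h)) has_real_derivative P' * h) (at 0)"
    by (rule DERIV_chain2[where f = P, OF _ lin]) (use P in simp)
  have \<mu>h: "((\<lambda>\<epsilon>. \<mu> (r + \<epsilon> * h)) has_real_derivative \<mu>' * h) (at 0)"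
    by (rule DERIV_chain2[where f = \<mu>, OF _ lin]) (use \<mu> in simp)
  show ?thesis
    unfolding dens_def
    \<comment> \<open>The rules deliver the value at \<epsilon> = 0 in unreduced form; with
      divisions written as inverses, matching it with the goal is a ring identity.\<close>
    apply (rule derivative_eq_intros refl Ph \<mu>h | (use r in simp; fail))+
    apply (simp_all only: mult_zero_left add_0_right)
    unfolding divide_inverse inverse_mult_distrib power_inverse power2_eq_square
    apply (simp add: algebra_simps)
    done
qed

(* The derivative of dens regrouped as the Euler-Lagrange expressions times the perturbations, plus
   a t-derivative and an x-derivative; W stands for the x-derivative of w, fx for that of the flux f. *)
lemma dens_derivative_split:
  fixes r :: real
  assumes r: "0 < r" and w: "w = \<mu>r * \<psi>x"
    and f: "f = m\<^sup>2 / r + Pr + \<mu>r * a - \<beta> * (\<mu>r * ((mx * r - m * rx) / r\<^sup>2))"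
  shows "a * b * \<mu>r + 1/2 * a\<^sup>2 * (\<mu>' * h) + (p * (rt + mx) + \<phi> * (ht + nx)) + (q * mt + \<psi> * nt)
      - (qx * (m\<^sup>2 / r + Pr + \<mu>r * a - \<beta> * (\<mu>r * ((mx * r - m * rx) / r\<^sup>2)))
        + \<psi>x * ((2 * m * n * r - m\<^sup>2 * h) / r\<^sup>2 + P' * h + (\<mu>' * h * a + \<mu>r * b)
          - \<beta> * (\<mu>' * h * ((mx * r - m * rx) / r\<^sup>2)
            + \<mu>r * (((nx * r + mx * h - n * rx - m * hx) * r\<^sup>2 - (mx * r - m * rx) * (2 * r * h)) / (r\<^sup>2 * r\<^sup>2)))))
    = (1/2 * a\<^sup>2 * \<mu>' - \<phi>t + m\<^sup>2 / r\<^sup>2 * \<psi>x - P' * \<psi>x - \<psi>x * \<mu>' * a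
        + \<beta> * \<psi>x * ((mx * r - m * rx) / r\<^sup>2) * \<mu>' + \<beta> * (m / r\<^sup>2) * W) * h
      + (- \<phi>x - \<psi>t - 2 * \<psi>x * (m / r) - \<beta> * (1 / r) * W) * n
      + (a - \<psi>x) * \<mu>r * b + (rt + mx) * p + (mt + fx) * q
      + ((\<phi>t * h + \<phi> * ht) + (\<psi>t * n + \<psi> * nt))
      + ((\<phi>x * n + \<phi> * nx) - (qx * f + q * fx)
        + \<beta> * ((W * (n / r) + w * ((nx * r - n * rx) / r\<^sup>2))
          - (W * (m * h / (r * r)) + w * (((mx * h + m * hx) * (r * r) - m * h * (rx * r + r * rx)) / (r * r)\<^sup>2))))"
proof -
  \<comment> \<open>With \<open>i\<close> for \<open>1 / r\<close> the claim is a polynomial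
    identity modulo \<open>r * i = 1\<close>.\<close>
  define i where "i = inverse r"
  have ri: "r * i = 1" using r by (simp add: i_def)
  show ?thesis
    unfolding f w divide_inverse inverse_mult_distrib power_inverse power2_eq_square mult_1_left i_def[symmetric]
    using ri by algebra
qed

definition flux where
  "flux \<beta> P \<mu> r m a t x =
     (m t x)\<^sup>2 / r t x + P (r t x) + \<mu> (r t x) * a t x - \<beta> * (\<mu> (r t x) * \<partial>\<^sub>x (\<lambda>t x. m t x / r t x) t x)"

definition action_density where
  "action_density \<beta> P \<mu> r m a \<phi> \<psi> t x =
     dens \<beta> P \<mu> (r t x) (\<partial>\<^sub>t r t x) (\<partial>\<^sub>x r t x) (m t x) (\<partial>\<^sub>t m t x) (\<partial>\<^sub>x m t x) (a t x) (\<phi> t x) (\<psi> t x) (\<partial>\<^sub>x \<psi> t x)"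

text \<open>Taken over a planar box, so that one application of
  \<open>has_derivative_integral_smooth\<close> differentiates it;
  \<open>smooth_field_integral_box\<close> returns to iterated integrals.\<close>

definition weak_action where
  "weak_action \<beta> P \<mu> r m a \<phi> \<psi> =
     integral (cbox (0, 0) (1, 1)) (\<lambda>z. action_density \<beta> P \<mu> r m a \<phi> \<psi> (fst z) (snd z))"

(* EL_rho and EL_m leave out the contributions of F, whose variations are smooth in x for each t
   but depend on t only weakly. *)
definition EL_rho where
  "EL_rho \<beta> P \<mu> r m a \<phi> \<psi> t x =
     1/2 * (a t x)\<^sup>2 * deriv \<mu> (r t x) - \<partial>\<^sub>t \<phi> t x + (m t x)\<^sup>2 / (r t x)\<^sup>2 * \<partial>\<^sub>x \<psi> t x
     - deriv P (r t x) * \<partial>\<^sub>x \<psi> t x - \<partial>\<^sub>x \<psi> t x * deriv \<mu> (r t x) * a t x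
     + \<beta> * \<partial>\<^sub>x \<psi> t x * \<partial>\<^sub>x (\<lambda>t x. m t x / r t x) t x * deriv \<mu> (r t x)
     + \<beta> * (m t x / (r t x)\<^sup>2) * \<partial>\<^sub>x (\<lambda>t x. \<mu> (r t x) * \<partial>\<^sub>x \<psi> t x) t x"

definition EL_m where
  "EL_m \<beta> \<mu> r m \<phi> \<psi> t x =
     - \<partial>\<^sub>x \<phi> t x - \<partial>\<^sub>t \<psi> t x - 2 * \<partial>\<^sub>x \<psi> t x * (m t x / r t x)
     - \<beta> * (1 / r t x) * \<partial>\<^sub>x (\<lambda>t x. \<mu> (r t x) * \<partial>\<^sub>x \<psi> t x) t x"

text \<open>A locale, so that the same facts can be instantiated at the perturbed fields as
  well.\<close>

locale flow_fields =
  fixes \<beta> :: real and P \<mu> :: "real \<Rightarrow> real" and r m a \<phi> \<psi> :: "real \<Rightarrow> real \<Rightarrow> real"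
  assumes P: "smooth_on {0<..} P" and \<mu>: "smooth_on {0<..} \<mu>"
    and r: "smooth_field r" and m: "smooth_field m" and a: "smooth_field a"
    and \<phi>: "smooth_field \<phi>" and \<psi>: "smooth_field \<psi>"
    and pos: "\<And>t x. t \<in> {0..1} \<Longrightarrow> 0 < r t x"
begin

lemma compose_r [field_intros]: "smooth_on {0<..} g \<Longrightarrow> smooth_field (\<lambda>t x. g (r t x))"
  by (rule smooth_field_compose[OF _ r pos])

lemma divide_r [field_intros]: "smooth_field u \<Longrightarrow> smooth_field (\<lambda>t x. u t x / r t x)"
  by (rule smooth_field_divide[OF _ r pos])

lemma divide_r2 [field_intros]: "smooth_field u \<Longrightarrow> smooth_field (\<lambda>t x. u t x / (r t x)\<^sup>2)"
  by (erule smooth_field_divide[OF _ smooth_field_power2[OF r]]) (rule zero_less_power[OF pos])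

lemma smooth_deriv_P: "smooth_on {0<..} (deriv P)" and smooth_deriv_\<mu>: "smooth_on {0<..} (deriv \<mu>)"
  using smooth_on_deriv(1) P \<mu> by auto

lemmas field_facts = field_intros P \<mu> smooth_deriv_P smooth_deriv_\<mu> r m a \<phi> \<psi>

lemma smooth_flux: "smooth_field (flux \<beta> P \<mu> r m a)"
  unfolding flux_def[abs_def] by (intro field_facts)

lemma smooth_mass: "smooth_field (mass_residual r m)"
  unfolding mass_residual_def[abs_def] by (intro field_facts)

lemma smooth_momentum: "smooth_field (momentum_residual \<beta> P \<mu> r m a)"
  unfolding momentum_residual_def[abs_def] by (intro field_facts)

lemma smooth_EL_rho: "smooth_field (EL_rho \<beta> P \<mu> r m a \<phi> \<psi>)"
  unfolding EL_rho_def[abs_def] by (intro field_facts)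

lemma smooth_EL_m: "smooth_field (EL_m \<beta> \<mu> r m \<phi> \<psi>)"
proof -
  \<comment> \<open>The leading minus is written as a difference from 0 to match the closure
    rules.\<close>
  have "smooth_field (\<lambda>t x. (0 - \<partial>\<^sub>x \<phi> t x) - \<partial>\<^sub>t \<psi> t x - 2 * \<partial>\<^sub>x \<psi> t x * (m t x / r t x)
     - \<beta> * (1 / r t x) * \<partial>\<^sub>x (\<lambda>t x. \<mu> (r t x) * \<partial>\<^sub>x \<psi> t x) t x)"
    by (intro field_facts)
  then show ?thesis by (simp add: EL_m_def[abs_def])
qed

text \<open>Conservation form: all spatial terms are one x-derivative, so a single integration by
  parts moves it onto \<open>\<psi>\<close>.\<close>

lemma momentum_residual_flux:
  assumes t: "t \<in> {0..1}"
  shows "momentum_residual \<beta> P \<mu> r m a t x = \<partial>\<^sub>t m t x + \<partial>\<^sub>x (flux \<beta> P \<mu> r m a) t x"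
proof -
  have 1: "smooth_field (\<lambda>t x. (m t x)\<^sup>2 / r t x)" by (intro field_facts)
  have 2: "smooth_field (\<lambda>t x. P (r t x))" by (intro field_facts)
  have 3: "smooth_field (\<lambda>t x. \<mu> (r t x) * a t x)" by (intro field_facts)
  have 4: "smooth_field (\<lambda>t x. \<mu> (r t x) * \<partial>\<^sub>x (\<lambda>t x. m t x / r t x) t x)" by (intro field_facts)
  note 12 = smooth_field_add[OF 1 2]
  note 123 = smooth_field_add[OF 12 3]
  show ?thesis
    unfolding momentum_residual_def flux_def[abs_def]
      dx_diff[OF 123 smooth_field_mult[OF smooth_field_const 4] t] dx_cmult[OF 4 t] dx_add[OF 12 3 t] dx_add[OF 1 2 t]
    by simp
qed

text \<open>The product rule for \<open>\<psi>\<close> times the flux. The exact x-derivative on the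
  right is lost on integration over the torus.\<close>

lemma action_density_eq:
  assumes t: "t \<in> {0..1}"
  shows "action_density \<beta> P \<mu> r m a \<phi> \<psi> t x =
    1/2 * (a t x)\<^sup>2 * \<mu> (r t x) + \<phi> t x * mass_residual r m t x + \<psi> t x * momentum_residual \<beta> P \<mu> r m a t x
    - \<partial>\<^sub>x (\<lambda>t x. \<psi> t x * flux \<beta> P \<mu> r m a t x) t x"
  unfolding action_density_def dens_def momentum_residual_flux[OF t] mass_residual_def
    dx_mult[OF \<psi> smooth_flux t]
  unfolding flux_def[of _ _ _ _ _ _ t x] dx_divide[OF m r t pos[OF t]]
  by (simp add: distrib_left)

lemma smooth_action_density: "smooth_field (action_density \<beta> P \<mu> r m a \<phi> \<psi>)"
  unfolding action_density_def[abs_def] dens_def by (intro field_facts)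

lemma lagrangian_weak:
  assumes "smooth_functional F"
  shows "lagrangian \<beta> P \<mu> F H r m a \<phi> \<psi> =
    weak_action \<beta> P \<mu> r m a \<phi> \<psi> - integral {0..1} (\<lambda>t. F (r t) (m t)) + H (r 1) (m 1)"
proof -
  let ?A = "\<lambda>t x. 1/2 * (a t x)\<^sup>2 * \<mu> (r t x)" and ?B = "\<lambda>t x. \<phi> t x * mass_residual r m t x"
    and ?C = "\<lambda>t x. \<psi> t x * momentum_residual \<beta> P \<mu> r m a t x"
    and ?G = "\<lambda>t x. \<psi> t x * flux \<beta> P \<mu> r m a t x"
  have s: "smooth_field ?A" "smooth_field ?B" "smooth_field ?C" "smooth_field ?G"
    by (intro field_facts smooth_mass smooth_momentum smooth_flux)+
  have dG: "smooth_field (\<partial>\<^sub>x ?G)" by (rule smooth_field_dx[OF s(4)])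
  note ts = s[THEN smooth_field_integral_continuous, THEN integrable_continuous_real]
  \<comment> \<open>Continuity of \<open>F\<close> along the fields gives the integrability needed
    to split it off the time integral.\<close>
  have tF: "(\<lambda>t. F (r t) (m t)) integrable_on {0..1}"
    using smooth_functional_continuous[OF assms r m pos] by (intro integrable_continuous_real) auto
  have "integral {0..1} (\<lambda>x. action_density \<beta> P \<mu> r m a \<phi> \<psi> t x) =
      integral {0..1} (?A t) + integral {0..1} (?B t) + integral {0..1} (?C t)" if t: "t \<in> {0..1}" for t
  proof -
    note i = s(1-3)[THEN smooth_field_integrable, OF t] dG[THEN smooth_field_integrable, OF t]
    have "integral {0..1} (\<lambda>x. action_density \<beta> P \<mu> r m a \<phi> \<psi> t x) =
        integral {0..1} (\<lambda>x. ?A t x + ?B t x + ?C t x - \<partial>\<^sub>x ?G t x)"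
      by (simp add: action_density_eq[OF t])
    also have "\<dots> = integral {0..1} (?A t) + integral {0..1} (?B t) + integral {0..1} (?C t) - integral {0..1} (\<partial>\<^sub>x ?G t)"
      using i by (simp only: integral_add integral_diff integrable_add)
    finally show ?thesis by (simp add: integral_dx_eq_0[OF s(4) t])
  qed
  then have "weak_action \<beta> P \<mu> r m a \<phi> \<psi> =
      integral {0..1} (\<lambda>t. integral {0..1} (?A t) + integral {0..1} (?B t) + integral {0..1} (?C t))"
    unfolding weak_action_def smooth_field_integral_box[OF smooth_action_density] by (intro integral_cong) simp
  also have "\<dots> = integral {0..1} (\<lambda>t. integral {0..1} (?A t)) + integral {0..1} (\<lambda>t. integral {0..1} (?B t))
      + integral {0..1} (\<lambda>t. integral {0..1} (?C t))"
    using ts by (simp only: integral_add integrable_add)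
  finally have W: "weak_action \<beta> P \<mu> r m a \<phi> \<psi> = \<dots>" .
  have O: "integral {0..1} (\<lambda>t. integral {0..1} (?A t) - F (r t) (m t)) =
      integral {0..1} (\<lambda>t. integral {0..1} (?A t)) - integral {0..1} (\<lambda>t. F (r t) (m t))"
    using ts(1) tF by (rule integral_diff)
  show ?thesis
    unfolding lagrangian_def objective_def W O by simp
qed

end

section \<open>First variation of the weak action\<close>

lemma (in flow_fields) fields_perturb:
  assumes "smooth_field h" "smooth_field n" "smooth_field b" "smooth_field p" "smooth_field q"
    and "\<And>t x. t \<in> {0..1} \<Longrightarrow> 0 < r t x + \<epsilon> * h t x"
  shows "flow_fields P \<mu> (\<lambda>t x. r t x + \<epsilon> * h t x) (\<lambda>t x. m t x + \<epsilon> * n t x) (\<lambda>t x. a t x + \<epsilon> * b t x)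
    (\<lambda>t x. \<phi> t x + \<epsilon> * p t x) (\<lambda>t x. \<psi> t x + \<epsilon> * q t x)"
  using assms P \<mu> r m a \<phi> \<psi> by unfold_locales (auto intro: smooth_field_perturb)

lemma dx_perturb: "smooth_field u \<Longrightarrow> smooth_field h \<Longrightarrow> t \<in> {0..1} \<Longrightarrow>
    \<partial>\<^sub>x (\<lambda>t x. u t x + \<epsilon> * h t x) t x = \<partial>\<^sub>x u t x + \<epsilon> * \<partial>\<^sub>x h t x"
  by (simp add: dx_add dx_cmult smooth_field_mult smooth_field_const)

lemma dt_perturb: "smooth_field u \<Longrightarrow> smooth_field h \<Longrightarrow> t \<in> {0..1} \<Longrightarrow>
    \<partial>\<^sub>t (\<lambda>t x. u t x + \<epsilon> * h t x) t x = \<partial>\<^sub>t u t x + \<epsilon> * \<partial>\<^sub>t h t x"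
  by (simp add: dt_add dt_cmult smooth_field_mult smooth_field_const)

text \<open>The differentiated density is the Euler-Lagrange pairing \<open>A\<close> plus a time
  derivative of \<open>T\<close> and a space derivative of \<open>G\<close>. The last integrates to
  zero; the other leaves the terms at the two end times.\<close>

lemma (in flow_fields) weak_action_has_derivative:
  assumes h: "smooth_field h" and n: "smooth_field n" and b: "smooth_field b" and p: "smooth_field p" and q: "smooth_field q"
  shows "((\<lambda>\<epsilon>. weak_action \<beta> P \<mu> (\<lambda>t x. r t x + \<epsilon> * h t x) (\<lambda>t x. m t x + \<epsilon> * n t x) (\<lambda>t x. a t x + \<epsilon> * b t x)
      (\<lambda>t x. \<phi> t x + \<epsilon> * p t x) (\<lambda>t x. \<psi> t x + \<epsilon> * q t x)) has_real_derivative
      integral {0..1} (\<lambda>t. integral {0..1} (\<lambda>x. EL_rho \<beta> P \<mu> r m a \<phi> \<psi> t x * h t x + EL_m \<beta> \<mu> r m \<phi> \<psi> t x * n t x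
        + (a t x - \<partial>\<^sub>x \<psi> t x) * \<mu> (r t x) * b t x + mass_residual r m t x * p t x
        + momentum_residual \<beta> P \<mu> r m a t x * q t x))
      + integral {0..1} (\<lambda>x. (\<phi> 1 x * h 1 x + \<psi> 1 x * n 1 x) - (\<phi> 0 x * h 0 x + \<psi> 0 x * n 0 x))) (at 0)"
proof -
  obtain e where e: "0 < e" and epos: "\<And>\<epsilon> t x. \<epsilon> \<in> {-e..e} \<Longrightarrow> t \<in> {0..1} \<Longrightarrow> 0 < r t x + \<epsilon> * h t x"
    using perturbation_positive[OF r pos h] by blast
  let ?box = "cbox (0::real, 0::real) (1, 1)"
  have box: "?box = {0..1} \<times> {0..1}" by (simp add: cbox_Pair_eq)
  define K where "K \<epsilon> z = (case z of (t, x) \<Rightarrow>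
    dens \<beta> P \<mu> (r t x + \<epsilon> * h t x) (\<partial>\<^sub>t r t x + \<epsilon> * \<partial>\<^sub>t h t x) (\<partial>\<^sub>x r t x + \<epsilon> * \<partial>\<^sub>x h t x)
      (m t x + \<epsilon> * n t x) (\<partial>\<^sub>t m t x + \<epsilon> * \<partial>\<^sub>t n t x) (\<partial>\<^sub>x m t x + \<epsilon> * \<partial>\<^sub>x n t x) (a t x + \<epsilon> * b t x)
      (\<phi> t x + \<epsilon> * p t x) (\<psi> t x + \<epsilon> * q t x) (\<partial>\<^sub>x \<psi> t x + \<epsilon> * \<partial>\<^sub>x q t x))" for \<epsilon> z
  \<comment> \<open>Collects what integration by parts in time takes off \<open>h\<close> and
    \<open>n\<close>; its end values form the boundary integral.\<close>
  define T where "T t x = \<phi> t x * h t x + \<psi> t x * n t x" for t x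
  define w where "w t x = \<mu> (r t x) * \<partial>\<^sub>x \<psi> t x" for t x
  \<comment> \<open>Each summand moves one x-derivative: \<open>\<phi> * n\<close> the one on
    \<open>n\<close> in the mass equation, \<open>q\<close> times the flux the one on
    \<open>q\<close>, and the \<beta>-part the one on \<open>n / r - m * h / r\<^sup>2\<close>, the
    variation of the velocity, which is weighted by \<open>w\<close>.\<close>
  define G where "G t x = (\<phi> t x * n t x - q t x * flux \<beta> P \<mu> r m a t x)
    + \<beta> * (w t x * (n t x / r t x) - w t x * (m t x * h t x / (r t x * r t x)))" for t x
  define A where "A t x = EL_rho \<beta> P \<mu> r m a \<phi> \<psi> t x * h t x + EL_m \<beta> \<mu> r m \<phi> \<psi> t x * n t x
        + (a t x - \<partial>\<^sub>x \<psi> t x) * \<mu> (r t x) * b t x + mass_residual r m t x * p t x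
        + momentum_residual \<beta> P \<mu> r m a t x * q t x" for t x
  define D where "D z = A (fst z) (snd z) + \<partial>\<^sub>t T (fst z) (snd z) + \<partial>\<^sub>x G (fst z) (snd z)" for z
  have sw: "smooth_field w" unfolding w_def[abs_def] by (intro field_facts)
  have rr: "smooth_field (\<lambda>t x. u t x / (r t x * r t x))" if "smooth_field u" for u
    using divide_r2[OF that] by (simp add: power2_eq_square)
  have sT: "smooth_field T" unfolding T_def[abs_def] by (intro field_facts h n)
  have sG: "smooth_field G" unfolding G_def[abs_def]
    by (intro rr field_facts h n q sw smooth_flux)
  have sA: "smooth_field A" unfolding A_def[abs_def]
    by (intro field_facts h n b p q smooth_EL_rho smooth_EL_m smooth_mass smooth_momentum)
  have dT: "\<partial>\<^sub>t T t x = (\<partial>\<^sub>t \<phi> t x * h t x + \<phi> t x * \<partial>\<^sub>t h t x) + (\<partial>\<^sub>t \<psi> t x * n t x + \<psi> t x * \<partial>\<^sub>t n t x)"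
    if t: "t \<in> {0..1}" for t x
    unfolding T_def[abs_def] dt_add[OF smooth_field_mult[OF \<phi> h] smooth_field_mult[OF \<psi> n] t]
      dt_mult[OF \<phi> h t] dt_mult[OF \<psi> n t] ..
  have dG: "\<partial>\<^sub>x G t x = ((\<partial>\<^sub>x \<phi> t x * n t x + \<phi> t x * \<partial>\<^sub>x n t x)
        - (\<partial>\<^sub>x q t x * flux \<beta> P \<mu> r m a t x + q t x * \<partial>\<^sub>x (flux \<beta> P \<mu> r m a) t x))
      + \<beta> * ((\<partial>\<^sub>x w t x * (n t x / r t x) + w t x * ((\<partial>\<^sub>x n t x * r t x - n t x * \<partial>\<^sub>x r t x) / (r t x)\<^sup>2))
        - (\<partial>\<^sub>x w t x * (m t x * h t x / (r t x * r t x)) + w t x *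
          (((\<partial>\<^sub>x m t x * h t x + m t x * \<partial>\<^sub>x h t x) * (r t x * r t x)
            - m t x * h t x * (\<partial>\<^sub>x r t x * r t x + r t x * \<partial>\<^sub>x r t x)) / (r t x * r t x)\<^sup>2)))"
    if t: "t \<in> {0..1}" for t x
  proof -
    note mh = smooth_field_mult[OF m h] and r2 = smooth_field_mult[OF r r]
    have rr_pos: "0 < r t x * r t x" using pos[OF t] by simp
    have 1: "\<partial>\<^sub>x (\<lambda>t x. m t x * h t x / (r t x * r t x)) t x =
        ((\<partial>\<^sub>x m t x * h t x + m t x * \<partial>\<^sub>x h t x) * (r t x * r t x)
            - m t x * h t x * (\<partial>\<^sub>x r t x * r t x + r t x * \<partial>\<^sub>x r t x)) / (r t x * r t x)\<^sup>2"
      unfolding dx_divide[OF mh r2 t rr_pos] dx_mult[OF m h t] dx_mult[OF r r t] ..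
    have s1: "smooth_field (\<lambda>t x. \<phi> t x * n t x)" by (intro field_facts n)
    have s2: "smooth_field (\<lambda>t x. q t x * flux \<beta> P \<mu> r m a t x)" by (intro field_facts q smooth_flux)
    have s3: "smooth_field (\<lambda>t x. w t x * (n t x / r t x))" by (intro field_facts n sw)
    have s4: "smooth_field (\<lambda>t x. w t x * (m t x * h t x / (r t x * r t x)))" by (intro rr field_facts h sw)
    note s12 = smooth_field_diff[OF s1 s2] and s34 = smooth_field_diff[OF s3 s4]
    show ?thesis
      unfolding G_def[abs_def] dx_add[OF s12 smooth_field_mult[OF smooth_field_const s34] t] dx_cmult[OF s34 t]
        dx_diff[OF s1 s2 t] dx_diff[OF s3 s4 t] dx_mult[OF \<phi> n t] dx_mult[OF q smooth_flux t]
        dx_mult[OF sw divide_r[OF n] t] dx_divide[OF n r t pos[OF t]] dx_mult[OF sw rr[OF mh] t] 1 ..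
  qed
  have KD: "((\<lambda>\<epsilon>. K \<epsilon> z) has_real_derivative D z) (at 0)" if "z \<in> ?box" for z
  proof -
    obtain t x where z: "z = (t, x)" by (cases z)
    have t: "t \<in> {0..1}" using that by (simp add: z box)
    have rp: "r t x \<in> {0<..}" using pos[OF t] by simp
    \<comment> \<open>The long premise is the derivative delivered by
      \<open>dens_has_derivative\<close>; naming it allows \<open>D z\<close> to be replaced by
      exactly that expression before the rule is applied.\<close>
    have 1: "dens_derivative = D z" if "dens_derivative =
      a t x * b t x * \<mu> (r t x) + 1/2 * (a t x)\<^sup>2 * (deriv \<mu> (r t x) * h t x)
      + (p t x * (\<partial>\<^sub>t r t x + \<partial>\<^sub>x m t x) + \<phi> t x * (\<partial>\<^sub>t h t x + \<partial>\<^sub>x n t x)) + (q t x * \<partial>\<^sub>t m t x + \<psi> t x * \<partial>\<^sub>t n t x)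
      - (\<partial>\<^sub>x q t x * ((m t x)\<^sup>2 / r t x + P (r t x) + \<mu> (r t x) * a t x
          - \<beta> * (\<mu> (r t x) * ((\<partial>\<^sub>x m t x * r t x - m t x * \<partial>\<^sub>x r t x) / (r t x)\<^sup>2)))
        + \<partial>\<^sub>x \<psi> t x * ((2 * m t x * n t x * r t x - (m t x)\<^sup>2 * h t x) / (r t x)\<^sup>2 + deriv P (r t x) * h t x
          + (deriv \<mu> (r t x) * h t x * a t x + \<mu> (r t x) * b t x)
          - \<beta> * (deriv \<mu> (r t x) * h t x * ((\<partial>\<^sub>x m t x * r t x - m t x * \<partial>\<^sub>x r t x) / (r t x)\<^sup>2)
            + \<mu> (r t x) * (((\<partial>\<^sub>x n t x * r t x + \<partial>\<^sub>x m t x * h t x - n t x * \<partial>\<^sub>x r t x - m t x * \<partial>\<^sub>x h t x) * (r t x)\<^sup>2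
              - (\<partial>\<^sub>x m t x * r t x - m t x * \<partial>\<^sub>x r t x) * (2 * r t x * h t x)) / ((r t x)\<^sup>2 * (r t x)\<^sup>2)))))"
      for dens_derivative
    proof -
      have f: "flux \<beta> P \<mu> r m a t x = (m t x)\<^sup>2 / r t x + P (r t x) + \<mu> (r t x) * a t x
          - \<beta> * (\<mu> (r t x) * ((\<partial>\<^sub>x m t x * r t x - m t x * \<partial>\<^sub>x r t x) / (r t x)\<^sup>2))"
        unfolding flux_def dx_divide[OF m r t pos[OF t]] ..
      show ?thesis
        unfolding that dens_derivative_split[OF pos[OF t] w_def f, where W = "\<partial>\<^sub>x w t x"
            and \<phi>t = "\<partial>\<^sub>t \<phi> t x" and \<phi>x = "\<partial>\<^sub>x \<phi> t x" and \<psi>t = "\<partial>\<^sub>t \<psi> t x" and fx = "\<partial>\<^sub>x (flux \<beta> P \<mu> r m a) t x"]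
        unfolding D_def z fst_conv snd_conv A_def dT[OF t] dG[OF t] EL_rho_def EL_m_def mass_residual_def
          momentum_residual_flux[OF t] dx_divide[OF m r t pos[OF t]] w_def[abs_def, symmetric] ..
    qed
    show ?thesis
      unfolding K_def z prod.case 1[OF refl, unfolded z, symmetric]
      by (rule dens_has_derivative[OF pos[OF t] smooth_on_deriv(2)[OF _ P rp] smooth_on_deriv(2)[OF _ \<mu> rp]]) auto
  qed
  \<comment> \<open>The field lemmas give smoothness on the strip over all x, and the fat box
    inherits it.\<close>
  have sK: "smooth_on ({-e..e} \<times> ?box) (\<lambda>w. K (fst w) (snd w))"
  proof (rule smooth_on_subset)
    let ?S = "{-e..e} \<times> ({0..1::real} \<times> (UNIV :: real set))"
    have fat: "fat ?S" using e by simp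
    have S: "smooth_on ?S (\<lambda>w. u (fst (snd w)) (snd (snd w)) + fst w * v (fst (snd w)) (snd (snd w)))"
      if "smooth_field u" "smooth_field v" for u v
      using smooth_on_perturb[OF that e] .
    have R: "0 < r (fst (snd w)) (snd (snd w)) + fst w * h (fst (snd w)) (snd (snd w))" if "w \<in> ?S" for w
      using that by (intro epos) auto
    have C: "smooth_on ?S (\<lambda>w. g (r (fst (snd w)) (snd (snd w)) + fst w * h (fst (snd w)) (snd (snd w))))"
      if "smooth_on {0<..} g" for g
      using R by (intro smooth_on_compose[OF fat that S[OF r h]]) auto
    show "smooth_on ?S (\<lambda>w. K (fst w) (snd w))"
      unfolding K_def dens_def case_prod_unfold
      by (intro C[OF P] C[OF \<mu>] S[OF r h] S[OF m n] S[OF a b] S[OF \<phi> p] S[OF \<psi> q]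
          S[OF smooth_field_dt[OF r] smooth_field_dt[OF h]] S[OF smooth_field_dx[OF r] smooth_field_dx[OF h]]
          S[OF smooth_field_dt[OF m] smooth_field_dt[OF n]] S[OF smooth_field_dx[OF m] smooth_field_dx[OF n]]
          S[OF smooth_field_dx[OF \<psi>] smooth_field_dx[OF q]] smooth_intros fat R zero_less_power)
    show "fat ({-e..e} \<times> ?box)" using e by (simp add: box)
  qed (auto simp: box)
  have "((\<lambda>\<epsilon>. integral ?box (K \<epsilon>)) has_real_derivative integral ?box D) (at 0)"
    by (rule has_derivative_integral_smooth(1)[OF e _ sK KD]) (simp_all add: box)
  then have 1: "((\<lambda>\<epsilon>. weak_action \<beta> P \<mu> (\<lambda>t x. r t x + \<epsilon> * h t x) (\<lambda>t x. m t x + \<epsilon> * n t x) (\<lambda>t x. a t x + \<epsilon> * b t x)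
      (\<lambda>t x. \<phi> t x + \<epsilon> * p t x) (\<lambda>t x. \<psi> t x + \<epsilon> * q t x)) has_real_derivative integral ?box D) (at 0)"
  proof (rule back_subst[where P = "\<lambda>f. (f has_real_derivative _) _"])
    \<comment> \<open>Derivatives of the perturbed fields are affine in \<epsilon>, so the perturbed
      density is \<open>K \<epsilon>\<close> for every \<epsilon>: the two integrals agree as
      functions, not just near 0.\<close>
    have "action_density \<beta> P \<mu> (\<lambda>t x. r t x + \<epsilon> * h t x) (\<lambda>t x. m t x + \<epsilon> * n t x) (\<lambda>t x. a t x + \<epsilon> * b t x)
      (\<lambda>t x. \<phi> t x + \<epsilon> * p t x) (\<lambda>t x. \<psi> t x + \<epsilon> * q t x) t x = K \<epsilon> (t, x)" if t: "t \<in> {0..1}" for \<epsilon> t x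
      unfolding action_density_def K_def prod.case dx_perturb[OF r h t] dx_perturb[OF m n t] dx_perturb[OF \<psi> q t]
        dt_perturb[OF r h t] dt_perturb[OF m n t] ..
    then show "(\<lambda>\<epsilon>. integral ?box (K \<epsilon>)) = (\<lambda>\<epsilon>. weak_action \<beta> P \<mu> (\<lambda>t x. r t x + \<epsilon> * h t x) (\<lambda>t x. m t x + \<epsilon> * n t x)
        (\<lambda>t x. a t x + \<epsilon> * b t x) (\<lambda>t x. \<phi> t x + \<epsilon> * p t x) (\<lambda>t x. \<psi> t x + \<epsilon> * q t x))"
      unfolding weak_action_def by (intro ext integral_cong) (auto simp: box)
  qed
  have 2: "integral ?box D = integral {0..1} (\<lambda>t. integral {0..1} (\<lambda>x. A t x + \<partial>\<^sub>t T t x + \<partial>\<^sub>x G t x))"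
    unfolding D_def by (rule smooth_field_integral_box) (intro field_intros sA sT sG)
  have 3: "integral {0..1} (\<lambda>x. A t x + \<partial>\<^sub>t T t x + \<partial>\<^sub>x G t x) = integral {0..1} (A t) + integral {0..1} (\<partial>\<^sub>t T t)"
    if t: "t \<in> {0..1}" for t
  proof -
    note i = sA[THEN smooth_field_integrable, OF t] smooth_field_dt[OF sT, THEN smooth_field_integrable, OF t]
      smooth_field_dx[OF sG, THEN smooth_field_integrable, OF t]
    show ?thesis
      using i by (simp only: integral_add integrable_add integral_dx_eq_0[OF sG t])
  qed
  have "integral ?box D = integral {0..1} (\<lambda>t. integral {0..1} (A t) + integral {0..1} (\<partial>\<^sub>t T t))"
    unfolding 2 by (intro integral_cong 3)
  also have "\<dots> = integral {0..1} (\<lambda>t. integral {0..1} (A t)) + integral {0..1} (\<lambda>t. integral {0..1} (\<partial>\<^sub>t T t))"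
    by (intro integral_add integrable_continuous_real smooth_field_integral_continuous sA smooth_field_dt sT)
  finally show ?thesis
    using 1 unfolding integral_dt[OF sT] unfolding A_def T_def by simp
qed

section \<open>Variations of the Lagrangian\<close>

text \<open>\<open>A\<close> is instantiated to the relation between \<open>a\<close> and
  \<open>\<psi>\<close>. The other equivalences hold only under it, so the conjuncts cannot be
  rewritten independently; \<open>M\<close> needs \<open>A\<close> along a whole time slice because
  \<open>a\<close> stands there under an x-derivative.\<close>

lemma conj_ball_iff:
  assumes "\<And>t x. (\<And>y. A t y) \<Longrightarrow> M t x \<longleftrightarrow> M' t x" and "\<And>t x. A t x \<Longrightarrow> R t x \<longleftrightarrow> R' t x"
  shows "((\<forall>t\<in>I. \<forall>x. R t x) \<and> B) \<and> ((\<forall>t\<in>I. \<forall>x. N t x) \<and> C) \<and> (\<forall>t\<in>I. \<forall>x. A t x) \<and>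
      (\<forall>t\<in>I. \<forall>x. D t x) \<and> (\<forall>t\<in>I. \<forall>x. M t x) \<longleftrightarrow>
    (\<forall>t\<in>I. \<forall>x. A t x) \<and> (\<forall>t\<in>I. \<forall>x. D t x \<and> M' t x \<and> R' t x \<and> N t x) \<and> B \<and> C"
proof (cases "\<forall>t\<in>I. \<forall>x. A t x")
  case True
  then have "M t x \<longleftrightarrow> M' t x" "R t x \<longleftrightarrow> R' t x" if "t \<in> I" for t x
    using assms that by blast+
  with True show ?thesis by blast
qed blast

context flow_fields
begin

text \<open>The Lagrangian is identified with its weak form only for small \<epsilon>, where the
  density stays positive; a derivative at 0 sees no more. \<open>F'\<close> and \<open>H'\<close>
  are left open so that the lemma serves every choice of perturbed fields.\<close>

lemma lagrangian_has_derivative: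
  assumes F: "smooth_functional F"
    and h: "smooth_field h" and n: "smooth_field n" and b: "smooth_field b" and p: "smooth_field p" and q: "smooth_field q"
    and FD: "((\<lambda>\<epsilon>. integral {0..1} (\<lambda>t. F (\<lambda>x. r t x + \<epsilon> * h t x) (\<lambda>x. m t x + \<epsilon> * n t x))) has_real_derivative F') (at 0)"
    and HD: "((\<lambda>\<epsilon>. H (\<lambda>x. r 1 x + \<epsilon> * h 1 x) (\<lambda>x. m 1 x + \<epsilon> * n 1 x)) has_real_derivative H') (at 0)"
  shows "((\<lambda>\<epsilon>. lagrangian \<beta> P \<mu> F H (\<lambda>t x. r t x + \<epsilon> * h t x) (\<lambda>t x. m t x + \<epsilon> * n t x) (\<lambda>t x. a t x + \<epsilon> * b t x)
      (\<lambda>t x. \<phi> t x + \<epsilon> * p t x) (\<lambda>t x. \<psi> t x + \<epsilon> * q t x)) has_real_derivative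
      integral {0..1} (\<lambda>t. integral {0..1} (\<lambda>x. EL_rho \<beta> P \<mu> r m a \<phi> \<psi> t x * h t x + EL_m \<beta> \<mu> r m \<phi> \<psi> t x * n t x
        + (a t x - \<partial>\<^sub>x \<psi> t x) * \<mu> (r t x) * b t x + mass_residual r m t x * p t x
        + momentum_residual \<beta> P \<mu> r m a t x * q t x))
      + integral {0..1} (\<lambda>x. (\<phi> 1 x * h 1 x + \<psi> 1 x * n 1 x) - (\<phi> 0 x * h 0 x + \<psi> 0 x * n 0 x))
      - F' + H') (at 0)"
proof -
  obtain e where e: "0 < e" and epos: "\<And>\<epsilon> t x. \<epsilon> \<in> {-e..e} \<Longrightarrow> t \<in> {0..1} \<Longrightarrow> 0 < r t x + \<epsilon> * h t x"
    using perturbation_positive[OF r pos h] by blast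
  show ?thesis
  proof (rule has_field_derivative_transform_within_open[OF DERIV_add[OF DERIV_diff[OF
          weak_action_has_derivative[OF h n b p q] FD] HD]])
    fix \<epsilon> assume "\<epsilon> \<in> {-e<..<e}"
    then interpret pert: flow_fields \<beta> P \<mu> "\<lambda>t x. r t x + \<epsilon> * h t x" "\<lambda>t x. m t x + \<epsilon> * n t x" "\<lambda>t x. a t x + \<epsilon> * b t x"
      "\<lambda>t x. \<phi> t x + \<epsilon> * p t x" "\<lambda>t x. \<psi> t x + \<epsilon> * q t x"
      by (intro fields_perturb h n b p q epos) auto
    show "weak_action \<beta> P \<mu> (\<lambda>t x. r t x + \<epsilon> * h t x) (\<lambda>t x. m t x + \<epsilon> * n t x) (\<lambda>t x. a t x + \<epsilon> * b t x)
          (\<lambda>t x. \<phi> t x + \<epsilon> * p t x) (\<lambda>t x. \<psi> t x + \<epsilon> * q t x)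
        - integral {0..1} (\<lambda>t. F (\<lambda>x. r t x + \<epsilon> * h t x) (\<lambda>x. m t x + \<epsilon> * n t x))
        + H (\<lambda>x. r 1 x + \<epsilon> * h 1 x) (\<lambda>x. m 1 x + \<epsilon> * n 1 x)
      = lagrangian \<beta> P \<mu> F H (\<lambda>t x. r t x + \<epsilon> * h t x) (\<lambda>t x. m t x + \<epsilon> * n t x) (\<lambda>t x. a t x + \<epsilon> * b t x)
          (\<lambda>t x. \<phi> t x + \<epsilon> * p t x) (\<lambda>t x. \<psi> t x + \<epsilon> * q t x)"
      by (rule pert.lagrangian_weak[OF F, symmetric])
  qed (use e in auto)
qed

lemma torus_var_rho: "smooth_functional F \<Longrightarrow> t \<in> {0..1} \<Longrightarrow> torus_smooth (var_rho F (r t) (m t))"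
  using has_var_rho[OF _ torus_smooth_slice[OF r] torus_smooth_slice[OF m] pos] by (auto simp: has_L2_variation_def)

lemma torus_var_m: "smooth_functional F \<Longrightarrow> t \<in> {0..1} \<Longrightarrow> torus_smooth (var_m F (r t) (m t))"
  using has_var_m[OF _ torus_smooth_slice[OF r] torus_smooth_slice[OF m] pos] by (auto simp: has_L2_variation_def)

text \<open>The pairing is split first at fixed time, where the variation of \<open>F\<close> is
  smooth in x, then in time, where weak continuity gives integrability. The boundary term at time 0
  drops since the perturbation vanishes there; the one at time 1 joins \<open>\<phi>\<close> to the
  variation of \<open>H\<close>.\<close>

lemma state_variation_rho_iff:
  assumes F: "smooth_functional F" and H: "smooth_functional H"
  shows "has_state_variation (\<lambda>r. lagrangian \<beta> P \<mu> F H r m a \<phi> \<psi>) r (\<lambda>_ _. 0) (\<lambda>_. 0) \<longleftrightarrow>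
    (\<forall>t\<in>{0..1}. \<forall>x. EL_rho \<beta> P \<mu> r m a \<phi> \<psi> t x - var_rho F (r t) (m t) x = 0) \<and>
    (\<forall>x. var_rho H (r 1) (m 1) x + \<phi> 1 x = 0)"
proof (rule has_state_variation_zero_iff)
  let ?E = "EL_rho \<beta> P \<mu> r m a \<phi> \<psi>" and ?V = "\<lambda>t. var_rho F (r t) (m t)"
  note sE = smooth_EL_rho
  have diff: "integral {0..1} (\<lambda>x. (?E t x - ?V t x) * h t x) =
      integral {0..1} (\<lambda>x. ?E t x * h t x) - integral {0..1} (\<lambda>x. ?V t x * h t x)"
    if "t \<in> {0..1}" "smooth_field h" for t h
    using that by (intro integral_torus_mult_diff torus_var_rho[OF F] torus_smooth_slice[OF sE] torus_smooth_slice)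
  show "torus_smooth (\<lambda>x. ?E t x - ?V t x)" if "t \<in> {0..1}" for t
    using that by (intro torus_smooth_diff torus_var_rho[OF F] torus_smooth_slice[OF sE])
  show "continuous_on {0..1} (\<lambda>t. integral {0..1} (\<lambda>x. (?E t x - ?V t x) * \<eta> x))" if "torus_smooth \<eta>" for \<eta>
  proof -
    have \<eta>: "smooth_field (\<lambda>t. \<eta>)" using that by (rule smooth_field_space)
    have "continuous_on {0..1} (\<lambda>t. integral {0..1} (\<lambda>x. ?E t x * \<eta> x) - integral {0..1} (\<lambda>x. ?V t x * \<eta> x))"
      by (intro continuous_on_diff has_derivative_functional_rho(2)[OF F r pos m \<eta>]
          smooth_field_integral_continuous[OF smooth_field_mult[OF sE \<eta>]])
    then show ?thesis
      by (rule continuous_on_eq) (rule diff[OF _ \<eta>, symmetric])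
  qed
  have one: "(1::real) \<in> {0..1}" by simp
  show "torus_smooth (\<lambda>x. var_rho H (r 1) (m 1) x + \<phi> 1 x)"
    by (intro torus_smooth_add torus_var_rho[OF H one] torus_smooth_slice[OF \<phi> one])
  fix h assume h: "smooth_field h" and h0: "\<And>x. h 0 x = 0"
  note zero = smooth_field_const[of 0]
  have HD: "((\<lambda>\<epsilon>. H (\<lambda>x. r 1 x + \<epsilon> * h 1 x) (m 1)) has_real_derivative
      integral {0..1} (\<lambda>x. var_rho H (r 1) (m 1) x * h 1 x)) (at 0)"
    using has_var_rho[OF H torus_smooth_slice[OF r one] torus_smooth_slice[OF m one] pos[OF one]] torus_smooth_slice[OF h one]
    unfolding has_L2_variation_def by blast
  have "((\<lambda>\<epsilon>. lagrangian \<beta> P \<mu> F H (\<lambda>t x. r t x + \<epsilon> * h t x) m a \<phi> \<psi>) has_real_derivative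
      integral {0..1} (\<lambda>t. integral {0..1} (\<lambda>x. ?E t x * h t x)) + integral {0..1} (\<lambda>x. \<phi> 1 x * h 1 x)
      - integral {0..1} (\<lambda>t. integral {0..1} (\<lambda>x. ?V t x * h t x))
      + integral {0..1} (\<lambda>x. var_rho H (r 1) (m 1) x * h 1 x)) (at 0)"
    using lagrangian_has_derivative[OF F h zero zero zero zero, of _ H] has_derivative_functional_rho(1)[OF F r pos m h] HD
    by (simp add: h0)
  also have "integral {0..1} (\<lambda>t. integral {0..1} (\<lambda>x. ?E t x * h t x)) + integral {0..1} (\<lambda>x. \<phi> 1 x * h 1 x)
      - integral {0..1} (\<lambda>t. integral {0..1} (\<lambda>x. ?V t x * h t x))
      + integral {0..1} (\<lambda>x. var_rho H (r 1) (m 1) x * h 1 x) =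
    integral {0..1} (\<lambda>t. integral {0..1} (\<lambda>x. (?E t x - ?V t x) * h t x))
      + integral {0..1} (\<lambda>x. (var_rho H (r 1) (m 1) x + \<phi> 1 x) * h 1 x)"
  proof -
    have "integral {0..1} (\<lambda>t. integral {0..1} (\<lambda>x. (?E t x - ?V t x) * h t x)) =
        integral {0..1} (\<lambda>t. integral {0..1} (\<lambda>x. ?E t x * h t x) - integral {0..1} (\<lambda>x. ?V t x * h t x))"
      by (intro integral_cong diff h)
    also have "\<dots> = integral {0..1} (\<lambda>t. integral {0..1} (\<lambda>x. ?E t x * h t x)) - integral {0..1} (\<lambda>t. integral {0..1} (\<lambda>x. ?V t x * h t x))"
      by (intro integral_diff integrable_continuous_real has_derivative_functional_rho(2)[OF F r pos m h]
          smooth_field_integral_continuous[OF smooth_field_mult[OF sE h]])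
    finally show ?thesis
      by (simp add: integral_torus_mult_add[OF torus_var_rho[OF H one] torus_smooth_slice[OF \<phi> one] torus_smooth_slice[OF h one]])
  qed
  finally show "((\<lambda>\<epsilon>. lagrangian \<beta> P \<mu> F H (\<lambda>t x. r t x + \<epsilon> * h t x) m a \<phi> \<psi>) has_real_derivative
      integral {0..1} (\<lambda>t. integral {0..1} (\<lambda>x. (?E t x - ?V t x) * h t x))
      + integral {0..1} (\<lambda>x. (var_rho H (r 1) (m 1) x + \<phi> 1 x) * h 1 x)) (at 0)" .
qed

text \<open>Parallel to the density case; the terminal multiplier is \<open>\<psi>\<close> because
  it is the one paired with the time derivative of \<open>m\<close>.\<close>

lemma state_variation_m_iff:
  assumes F: "smooth_functional F" and H: "smooth_functional H"
  shows "has_state_variation (\<lambda>n. lagrangian \<beta> P \<mu> F H r n a \<phi> \<psi>) m (\<lambda>_ _. 0) (\<lambda>_. 0) \<longleftrightarrow>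
    (\<forall>t\<in>{0..1}. \<forall>x. EL_m \<beta> \<mu> r m \<phi> \<psi> t x - var_m F (r t) (m t) x = 0) \<and>
    (\<forall>x. var_m H (r 1) (m 1) x + \<psi> 1 x = 0)"
proof (rule has_state_variation_zero_iff)
  let ?E = "EL_m \<beta> \<mu> r m \<phi> \<psi>" and ?V = "\<lambda>t. var_m F (r t) (m t)"
  note sE = smooth_EL_m
  have diff: "integral {0..1} (\<lambda>x. (?E t x - ?V t x) * h t x) =
      integral {0..1} (\<lambda>x. ?E t x * h t x) - integral {0..1} (\<lambda>x. ?V t x * h t x)"
    if "t \<in> {0..1}" "smooth_field h" for t h
    using that by (intro integral_torus_mult_diff torus_var_m[OF F] torus_smooth_slice[OF sE] torus_smooth_slice)
  show "torus_smooth (\<lambda>x. ?E t x - ?V t x)" if "t \<in> {0..1}" for t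
    using that by (intro torus_smooth_diff torus_var_m[OF F] torus_smooth_slice[OF sE])
  show "continuous_on {0..1} (\<lambda>t. integral {0..1} (\<lambda>x. (?E t x - ?V t x) * \<eta> x))" if "torus_smooth \<eta>" for \<eta>
  proof -
    have \<eta>: "smooth_field (\<lambda>t. \<eta>)" using that by (rule smooth_field_space)
    have "continuous_on {0..1} (\<lambda>t. integral {0..1} (\<lambda>x. ?E t x * \<eta> x) - integral {0..1} (\<lambda>x. ?V t x * \<eta> x))"
      by (intro continuous_on_diff has_derivative_functional_m(2)[OF F r pos m \<eta>]
          smooth_field_integral_continuous[OF smooth_field_mult[OF sE \<eta>]])
    then show ?thesis
      by (rule continuous_on_eq) (rule diff[OF _ \<eta>, symmetric])
  qed
  have one: "(1::real) \<in> {0..1}" by simp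
  show "torus_smooth (\<lambda>x. var_m H (r 1) (m 1) x + \<psi> 1 x)"
    by (intro torus_smooth_add torus_var_m[OF H one] torus_smooth_slice[OF \<psi> one])
  fix h assume h: "smooth_field h" and h0: "\<And>x. h 0 x = 0"
  note zero = smooth_field_const[of 0]
  have HD: "((\<lambda>\<epsilon>. H (r 1) (\<lambda>x. m 1 x + \<epsilon> * h 1 x)) has_real_derivative
      integral {0..1} (\<lambda>x. var_m H (r 1) (m 1) x * h 1 x)) (at 0)"
    using has_var_m[OF H torus_smooth_slice[OF r one] torus_smooth_slice[OF m one] pos[OF one]] torus_smooth_slice[OF h one]
    unfolding has_L2_variation_def by blast
  have "((\<lambda>\<epsilon>. lagrangian \<beta> P \<mu> F H r (\<lambda>t x. m t x + \<epsilon> * h t x) a \<phi> \<psi>) has_real_derivative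
      integral {0..1} (\<lambda>t. integral {0..1} (\<lambda>x. ?E t x * h t x)) + integral {0..1} (\<lambda>x. \<psi> 1 x * h 1 x)
      - integral {0..1} (\<lambda>t. integral {0..1} (\<lambda>x. ?V t x * h t x))
      + integral {0..1} (\<lambda>x. var_m H (r 1) (m 1) x * h 1 x)) (at 0)"
    using lagrangian_has_derivative[OF F zero h zero zero zero, of _ H] has_derivative_functional_m(1)[OF F r pos m h] HD
    by (simp add: h0)
  also have "integral {0..1} (\<lambda>t. integral {0..1} (\<lambda>x. ?E t x * h t x)) + integral {0..1} (\<lambda>x. \<psi> 1 x * h 1 x)
      - integral {0..1} (\<lambda>t. integral {0..1} (\<lambda>x. ?V t x * h t x))
      + integral {0..1} (\<lambda>x. var_m H (r 1) (m 1) x * h 1 x) =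
    integral {0..1} (\<lambda>t. integral {0..1} (\<lambda>x. (?E t x - ?V t x) * h t x))
      + integral {0..1} (\<lambda>x. (var_m H (r 1) (m 1) x + \<psi> 1 x) * h 1 x)"
  proof -
    have "integral {0..1} (\<lambda>t. integral {0..1} (\<lambda>x. (?E t x - ?V t x) * h t x)) =
        integral {0..1} (\<lambda>t. integral {0..1} (\<lambda>x. ?E t x * h t x) - integral {0..1} (\<lambda>x. ?V t x * h t x))"
      by (intro integral_cong diff h)
    also have "\<dots> = integral {0..1} (\<lambda>t. integral {0..1} (\<lambda>x. ?E t x * h t x)) - integral {0..1} (\<lambda>t. integral {0..1} (\<lambda>x. ?V t x * h t x))"
      by (intro integral_diff integrable_continuous_real has_derivative_functional_m(2)[OF F r pos m h]
          smooth_field_integral_continuous[OF smooth_field_mult[OF sE h]])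
    finally show ?thesis
      by (simp add: integral_torus_mult_add[OF torus_var_m[OF H one] torus_smooth_slice[OF \<psi> one] torus_smooth_slice[OF h one]])
  qed
  finally show "((\<lambda>\<epsilon>. lagrangian \<beta> P \<mu> F H r (\<lambda>t x. m t x + \<epsilon> * h t x) a \<phi> \<psi>) has_real_derivative
      integral {0..1} (\<lambda>t. integral {0..1} (\<lambda>x. (?E t x - ?V t x) * h t x))
      + integral {0..1} (\<lambda>x. (var_m H (r 1) (m 1) x + \<psi> 1 x) * h 1 x)) (at 0)" .
qed

text \<open>The functionals do not involve the control and contribute zero derivatives. The factor
  \<open>\<mu>\<close> stays until its positivity is at hand in the main theorem.\<close>

lemma field_variation_a_iff:
  assumes F: "smooth_functional F"
  shows "has_field_variation (\<lambda>b. lagrangian \<beta> P \<mu> F H r m b \<phi> \<psi>) a (\<lambda>_ _. 0) \<longleftrightarrow>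
    (\<forall>t\<in>{0..1}. \<forall>x. (a t x - \<partial>\<^sub>x \<psi> t x) * \<mu> (r t x) = 0)"
proof (rule has_field_variation_zero_iff)
  show "smooth_field (\<lambda>t x. (a t x - \<partial>\<^sub>x \<psi> t x) * \<mu> (r t x))"
    by (intro field_facts)
  fix h assume h: "smooth_field h"
  note zero = smooth_field_const[of 0]
  show "((\<lambda>\<epsilon>. lagrangian \<beta> P \<mu> F H r m (\<lambda>t x. a t x + \<epsilon> * h t x) \<phi> \<psi>) has_real_derivative
      integral {0..1} (\<lambda>t. integral {0..1} (\<lambda>x. (a t x - \<partial>\<^sub>x \<psi> t x) * \<mu> (r t x) * h t x))) (at 0)"
    using lagrangian_has_derivative[OF F zero zero h zero zero, of 0 H 0] by simp
qed

text \<open>The Lagrangian is affine in each multiplier, so varying one returns the constraint it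
  enforces; the same holds for \<open>\<psi>\<close>.\<close>

lemma field_variation_\<phi>_iff:
  assumes F: "smooth_functional F"
  shows "has_field_variation (\<lambda>p. lagrangian \<beta> P \<mu> F H r m a p \<psi>) \<phi> (\<lambda>_ _. 0) \<longleftrightarrow>
    (\<forall>t\<in>{0..1}. \<forall>x. mass_residual r m t x = 0)"
proof (rule has_field_variation_zero_iff[OF _ smooth_mass])
  fix h assume h: "smooth_field h"
  note zero = smooth_field_const[of 0]
  show "((\<lambda>\<epsilon>. lagrangian \<beta> P \<mu> F H r m a (\<lambda>t x. \<phi> t x + \<epsilon> * h t x) \<psi>) has_real_derivative
      integral {0..1} (\<lambda>t. integral {0..1} (\<lambda>x. mass_residual r m t x * h t x))) (at 0)"
    using lagrangian_has_derivative[OF F zero zero zero h zero, of 0 H 0] by simp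
qed

lemma field_variation_\<psi>_iff:
  assumes F: "smooth_functional F"
  shows "has_field_variation (\<lambda>q. lagrangian \<beta> P \<mu> F H r m a \<phi> q) \<psi> (\<lambda>_ _. 0) \<longleftrightarrow>
    (\<forall>t\<in>{0..1}. \<forall>x. momentum_residual \<beta> P \<mu> r m a t x = 0)"
proof (rule has_field_variation_zero_iff[OF _ smooth_momentum])
  fix h assume h: "smooth_field h"
  note zero = smooth_field_const[of 0]
  show "((\<lambda>\<epsilon>. lagrangian \<beta> P \<mu> F H r m a \<phi> (\<lambda>t x. \<psi> t x + \<epsilon> * h t x)) has_real_derivative
      integral {0..1} (\<lambda>t. integral {0..1} (\<lambda>x. momentum_residual \<beta> P \<mu> r m a t x * h t x))) (at 0)"
    using lagrangian_has_derivative[OF F zero zero zero zero h, of 0 H 0] by simp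
qed

end

text \<open>The multipliers of \<open>critical_point\<close> are the adjoint variables of the
  system, so the equivalence is proved for each smooth pair separately and the existential
  quantifiers then match.\<close>

theorem mainTheorem1:
  fixes \<beta> :: real
    and P \<mu> :: "real \<Rightarrow> real"
    and F H :: "(real \<Rightarrow> real) \<Rightarrow> (real \<Rightarrow> real) \<Rightarrow> real"
    and \<rho>0 m0 :: "real \<Rightarrow> real"
    and \<rho> m a :: "real \<Rightarrow> real \<Rightarrow> real"
  assumes "\<beta> > 0"
    and "smooth_on {0<..} P" and "smooth_on {0<..} \<mu>" and "\<And>r. r > 0 \<Longrightarrow> \<mu> r > 0"
    and "smooth_functional F" and "smooth_functional H"
    and "torus_smooth \<rho>0" and "torus_smooth m0" and "\<And>x. \<rho>0 x > 0"
    and "smooth_field \<rho>" and "smooth_field m" and "smooth_field a"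
    and "\<And>t x. t \<in> {0..1} \<Longrightarrow> \<rho> t x > 0"
  shows "critical_point \<beta> P \<mu> F H \<rho>0 m0 \<rho> m a \<longleftrightarrow>
    (\<exists>\<phi> \<psi>. smooth_field \<phi> \<and> smooth_field \<psi> \<and>
      (\<forall>t\<in>{0..1}. \<forall>x. a t x = \<partial>\<^sub>x \<psi> t x) \<and>
      (\<forall>t\<in>{0..1}. \<forall>x.
        \<partial>\<^sub>t \<rho> t x + \<partial>\<^sub>x m t x = 0 \<and>
        \<partial>\<^sub>t m t x + \<partial>\<^sub>x (\<lambda>t x. (m t x)\<^sup>2 / \<rho> t x) t x + \<partial>\<^sub>x (\<lambda>t x. P (\<rho> t x)) t x
            + \<partial>\<^sub>x (\<lambda>t x. \<mu> (\<rho> t x) * \<partial>\<^sub>x \<psi> t x) t x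
          = \<beta> * \<partial>\<^sub>x (\<lambda>t x. \<mu> (\<rho> t x) * \<partial>\<^sub>x (\<lambda>t x. m t x / \<rho> t x) t x) t x \<and>
        \<partial>\<^sub>t \<phi> t x + 1/2 * \<bar>\<partial>\<^sub>x \<psi> t x\<bar>\<^sup>2 * deriv \<mu> (\<rho> t x)
            - (m t x)\<^sup>2 / (\<rho> t x)\<^sup>2 * \<partial>\<^sub>x \<psi> t x
            + deriv P (\<rho> t x) * \<partial>\<^sub>x \<psi> t x
            + var_rho F (\<rho> t) (m t) x
          = \<beta> * \<partial>\<^sub>x \<psi> t x * \<partial>\<^sub>x (\<lambda>t x. m t x / \<rho> t x) t x * deriv \<mu> (\<rho> t x)
            + \<beta> * (m t x / (\<rho> t x)\<^sup>2) * \<partial>\<^sub>x (\<lambda>t x. \<mu> (\<rho> t x) * \<partial>\<^sub>x \<psi> t x) t x \<and>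
        \<partial>\<^sub>t \<psi> t x + 2 * \<partial>\<^sub>x \<psi> t x * (m t x / \<rho> t x) + \<partial>\<^sub>x \<phi> t x + var_m F (\<rho> t) (m t) x
          = - \<beta> * (1 / \<rho> t x) * \<partial>\<^sub>x (\<lambda>t x. \<mu> (\<rho> t x) * \<partial>\<^sub>x \<psi> t x) t x) \<and>
      (\<forall>x. \<rho> 0 x = \<rho>0 x \<and> m 0 x = m0 x \<and>
        var_rho H (\<rho> 1) (m 1) x + \<phi> 1 x = 0 \<and>
        var_m H (\<rho> 1) (m 1) x + \<psi> 1 x = 0))"
proof -
  let ?adj = "\<lambda>\<phi> \<psi> t x. \<partial>\<^sub>t \<phi> t x + 1/2 * \<bar>\<partial>\<^sub>x \<psi> t x\<bar>\<^sup>2 * deriv \<mu> (\<rho> t x)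
            - (m t x)\<^sup>2 / (\<rho> t x)\<^sup>2 * \<partial>\<^sub>x \<psi> t x
            + deriv P (\<rho> t x) * \<partial>\<^sub>x \<psi> t x
            + var_rho F (\<rho> t) (m t) x
          = \<beta> * \<partial>\<^sub>x \<psi> t x * \<partial>\<^sub>x (\<lambda>t x. m t x / \<rho> t x) t x * deriv \<mu> (\<rho> t x)
            + \<beta> * (m t x / (\<rho> t x)\<^sup>2) * \<partial>\<^sub>x (\<lambda>t x. \<mu> (\<rho> t x) * \<partial>\<^sub>x \<psi> t x) t x"
  have variations: "has_state_variation (\<lambda>r. lagrangian \<beta> P \<mu> F H r m a \<phi> \<psi>) \<rho> (\<lambda>_ _. 0) (\<lambda>_. 0) \<and>
        has_state_variation (\<lambda>n. lagrangian \<beta> P \<mu> F H \<rho> n a \<phi> \<psi>) m (\<lambda>_ _. 0) (\<lambda>_. 0) \<and>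
        has_field_variation (\<lambda>b. lagrangian \<beta> P \<mu> F H \<rho> m b \<phi> \<psi>) a (\<lambda>_ _. 0) \<and>
        has_field_variation (\<lambda>p. lagrangian \<beta> P \<mu> F H \<rho> m a p \<psi>) \<phi> (\<lambda>_ _. 0) \<and>
        has_field_variation (\<lambda>q. lagrangian \<beta> P \<mu> F H \<rho> m a \<phi> q) \<psi> (\<lambda>_ _. 0) \<longleftrightarrow>
      (\<forall>t\<in>{0..1}. \<forall>x. a t x = \<partial>\<^sub>x \<psi> t x) \<and>
      (\<forall>t\<in>{0..1}. \<forall>x.
        \<partial>\<^sub>t \<rho> t x + \<partial>\<^sub>x m t x = 0 \<and>
        \<partial>\<^sub>t m t x + \<partial>\<^sub>x (\<lambda>t x. (m t x)\<^sup>2 / \<rho> t x) t x + \<partial>\<^sub>x (\<lambda>t x. P (\<rho> t x)) t x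
            + \<partial>\<^sub>x (\<lambda>t x. \<mu> (\<rho> t x) * \<partial>\<^sub>x \<psi> t x) t x
          = \<beta> * \<partial>\<^sub>x (\<lambda>t x. \<mu> (\<rho> t x) * \<partial>\<^sub>x (\<lambda>t x. m t x / \<rho> t x) t x) t x \<and>
        ?adj \<phi> \<psi> t x \<and>
        \<partial>\<^sub>t \<psi> t x + 2 * \<partial>\<^sub>x \<psi> t x * (m t x / \<rho> t x) + \<partial>\<^sub>x \<phi> t x + var_m F (\<rho> t) (m t) x
          = - \<beta> * (1 / \<rho> t x) * \<partial>\<^sub>x (\<lambda>t x. \<mu> (\<rho> t x) * \<partial>\<^sub>x \<psi> t x) t x) \<and>
      (\<forall>x. var_rho H (\<rho> 1) (m 1) x + \<phi> 1 x = 0) \<and> (\<forall>x. var_m H (\<rho> 1) (m 1) x + \<psi> 1 x = 0)"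
    if "smooth_field \<phi>" "smooth_field \<psi>" for \<phi> \<psi>
  proof -
    interpret flow_fields \<beta> P \<mu> \<rho> m a \<phi> \<psi>
      using assms that by unfold_locales
    \<comment> \<open>Positivity of \<open>\<mu>\<close> along the positive density cancels the
      factor.\<close>
    have a_iff: "(\<forall>t\<in>{0..1}. \<forall>x. (a t x - \<partial>\<^sub>x \<psi> t x) * \<mu> (\<rho> t x) = 0) \<longleftrightarrow> (\<forall>t\<in>{0..1}. \<forall>x. a t x = \<partial>\<^sub>x \<psi> t x)"
      using assms(4)[OF pos] by (metis eq_iff_diff_eq_0 less_irrefl mult_eq_0_iff)
    have mom_iff: "momentum_residual \<beta> P \<mu> \<rho> m a t x = 0 \<longleftrightarrow>
        \<partial>\<^sub>t m t x + \<partial>\<^sub>x (\<lambda>t x. (m t x)\<^sup>2 / \<rho> t x) t x + \<partial>\<^sub>x (\<lambda>t x. P (\<rho> t x)) t x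
            + \<partial>\<^sub>x (\<lambda>t x. \<mu> (\<rho> t x) * \<partial>\<^sub>x \<psi> t x) t x
          = \<beta> * \<partial>\<^sub>x (\<lambda>t x. \<mu> (\<rho> t x) * \<partial>\<^sub>x (\<lambda>t x. m t x / \<rho> t x) t x) t x"
      if "\<And>y. a t y = \<partial>\<^sub>x \<psi> t y" for t x
    proof -
      \<comment> \<open>An x-derivative at time t reads only the slice at t, so agreement of
        \<open>a\<close> and \<open>\<partial>\<^sub>x \<psi>\<close> along that slice
        suffices.\<close>
      have "\<partial>\<^sub>x (\<lambda>t x. \<mu> (\<rho> t x) * a t x) t x = \<partial>\<^sub>x (\<lambda>t x. \<mu> (\<rho> t x) * \<partial>\<^sub>x \<psi> t x) t x"
        unfolding dx_def[of "\<lambda>t x. \<mu> (\<rho> t x) * a t x"] dx_def[of "\<lambda>t x. \<mu> (\<rho> t x) * \<partial>\<^sub>x \<psi> t x"] that ..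
      then show ?thesis unfolding momentum_residual_def by linarith
    qed
    have rho_iff: "EL_rho \<beta> P \<mu> \<rho> m a \<phi> \<psi> t x - var_rho F (\<rho> t) (m t) x = 0 \<longleftrightarrow> ?adj \<phi> \<psi> t x"
      if "a t x = \<partial>\<^sub>x \<psi> t x" for t x
    proof -
      \<comment> \<open>Once \<open>a\<close> is \<open>\<partial>\<^sub>x \<psi>\<close>, the cost
        contributes half of this product and the constraint minus the whole, which gives the net
        -1/2; the identity makes the comparison linear.\<close>
      have "\<partial>\<^sub>x \<psi> t x * deriv \<mu> (\<rho> t x) * \<partial>\<^sub>x \<psi> t x = 2 * (1/2 * (\<partial>\<^sub>x \<psi> t x)\<^sup>2 * deriv \<mu> (\<rho> t x))"
        by (simp add: power2_eq_square)
      then show ?thesis unfolding EL_rho_def that power2_abs by linarith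
    qed
    have m_iff: "EL_m \<beta> \<mu> \<rho> m \<phi> \<psi> t x - var_m F (\<rho> t) (m t) x = 0 \<longleftrightarrow>
        \<partial>\<^sub>t \<psi> t x + 2 * \<partial>\<^sub>x \<psi> t x * (m t x / \<rho> t x) + \<partial>\<^sub>x \<phi> t x + var_m F (\<rho> t) (m t) x
          = - \<beta> * (1 / \<rho> t x) * \<partial>\<^sub>x (\<lambda>t x. \<mu> (\<rho> t x) * \<partial>\<^sub>x \<psi> t x) t x" for t x
      unfolding EL_m_def mult_minus_left by linarith
    show ?thesis
      unfolding state_variation_rho_iff[OF assms(5,6)] state_variation_m_iff[OF assms(5,6)] field_variation_a_iff[OF assms(5)]
        field_variation_\<phi>_iff[OF assms(5)] field_variation_\<psi>_iff[OF assms(5)] a_iff m_iff mass_residual_def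
      by (rule conj_ball_iff[OF mom_iff rho_iff])
  qed
  show ?thesis
    unfolding critical_point_def
    \<comment> \<open>\<open>conj_cong\<close> supplies the smoothness of the multipliers, under
      which \<open>variations\<close> holds.\<close>
    by (simp only: variations cong: conj_cong) blast
qed

end
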